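(* Let $K$ be a finite and connected simplicial complex with $m$ vertices. Then there is an isomorphism $$\ddot{\mathrm{B}}_{i}^{j}(K) \cong \mathrm{DH}_{i-j+1,\,2j}(\mathcal{Z}_K)$$ for each $i\neq 0,-1$ (and each $j$). Equivalently, $$\mathrm{DH}_{-k,2l}(\mathcal{Z}_K) \cong \ddot{\mathrm{B}}_{l-k-1}^{l}(K)$$ for each choice of $l$ and $k$ such that $l-k\neq 0,1$.
   Context: All homology has coefficients in $\mathbb{Z}$. $K$ is a finite simplicial complex with vertex set $V=V(K)=\{v_1,\dots,v_m\}$, without ghost vertices (every $v_i$ is a $0$-simplex of $K$). For $I\subseteq V$, $K[I]$ is the subcomplex of $K$ of simplices with all vertices in $I$; $K[\emptyset]=\emptyset$. Identify $v_i$ with its index $i$ when comparing vertices. **0-degree überhomology $\ddot{\mathrm{B}}$.** A bicolouring is a map $\varepsilon\colon V\to\{0,1\}$; put $\ell(\varepsilon)=\sum_j\varepsilon(v_j)$. The weight $w_\varepsilon(\sigma)$ of a simplex $\sigma$ is the number of vertices of $\sigma$ coloured $0$. The simplicial differential on $C_*(K;\mathbb{Z})$ splits as a part $\partial_h$ preserving $w_\varepsilon$ and a part lowering it by one; the horizontal homology $\mathrm{H}^h(K,\varepsilon)$ is the homology of $(C_*(K;\mathbb{Z}),\partial_h)$, bigraded by weight and simplex dimension. Set $\ddot{\mathrm{C}}^j(K)=\bigoplus_{\ell(\varepsilon)=j}\mathrm{H}^h(K,\varepsilon)$. If $\varepsilon,\varepsilon'$ differ only at $v_i$, with $\varepsilon(v_i)=0$,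 $\varepsilon'(v_i)=1$, let $d_{\varepsilon,\varepsilon'}\colon \mathrm{H}^h(K,\varepsilon)\to \mathrm{H}^h(K,\varepsilon')$ be induced by $\sigma\mapsto(-1)^{s}\sigma$ if $w_\varepsilon(\sigma)=w_{\varepsilon'}(\sigma)$ and $\sigma\mapsto 0$ otherwise, where $s=|\{j<i : \varepsilon(v_j)=1\}|$. The differential $\ddot d^j\colon\ddot{\mathrm{C}}^j(K)\to\ddot{\mathrm{C}}^{j+1}(K)$ is the sum of all $d_{\varepsilon,\varepsilon'}$ with $\ell(\varepsilon)=j$; it preserves weight and simplex dimension. The überhomology $\ddot{\mathrm{H}}^j_{k,i}(K)$ is the part of the degree-$j$ cohomology of $(\ddot{\mathrm{C}}^*(K),\ddot d)$ in weight $k$ and simplex dimension $i$, and $\ddot{\mathrm{B}}^j_i(K):=\ddot{\mathrm{H}}^j_{0,i}(K)$. (Explicitly, in weight $0$ the group attached to $\varepsilon$ is $\mathrm{H}_i(K[I_\varepsilon])$, ordinary unreduced homology, with $I_\varepsilon=\varepsilon^{-1}(1)$, and $d_{\varepsilon,\varepsilon'}$ is up to sign the map induced by inclusion.) **Double homology $\mathrm{DH}$.** $\widetilde{\mathrm{H}}_*$ denotes reduced simplicial homology, with $\widetilde{\mathrm{H}}_p(\emptyset)=\mathbb{Z}$ if $p=-1$ and $0$ otherwise. The homology of the moment-angle complex $\mathcal{Z}_K$ decomposes as $\mathrm{H}_p(\mathcal{Z}_K)\cong\bigoplus_{2l-k=p}\mathrm{H}_{-k,2l}(\mathcal{Z}_K)$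 with $$\mathrm{H}_{-k,2l}(\mathcal{Z}_K)=\bigoplus_{I\subseteq V,\ |I|=l}\widetilde{\mathrm{H}}_{l-k-1}(K[I]).$$ Let $\phi_{p,I,j}\colon\widetilde{\mathrm{H}}_p(K[I])\to\widetilde{\mathrm{H}}_p(K[I\cup\{j\}])$ be induced by inclusion. The differential $\partial'_{-k,2l}\colon\mathrm{H}_{-k,2l}(\mathcal{Z}_K)\to\mathrm{H}_{-k-1,2l+2}(\mathcal{Z}_K)$ is given on the summand indexed by $I$, with $p=l-k-1$, by $$\partial'_p=(-1)^{p+1}\sum_{j\in V\setminus I}(-1)^{|\{i\in I:\, i<j\}|}\phi_{p,I,j}.$$ $\mathrm{DH}_{-k,2l}(\mathcal{Z}_K)$ is the homology of $(\mathrm{H}_{*,*}(\mathcal{Z}_K),\partial')$ in bidegree $(-k,2l)$. Groups in bidegrees where the chain groups are not defined are $0$. *)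

theory Defs
  imports "HOL-Algebra.Free_Abelian_Groups"
begin

section \<open>Simplicial complexes\<close>

text \<open>
  Simplices are nonempty, so that the full subcomplex on the empty vertex set is the empty
  complex. The vertex set is the union of the simplices, i.e. there are no ghost vertices. The
  linear order on the vertex type plays the role of the numbering of the vertices.
\<close>

definition simplicial_complex :: "'v set set \<Rightarrow> bool" where
  "simplicial_complex K \<longleftrightarrow>
     (\<forall>\<sigma>\<in>K. finite \<sigma> \<and> \<sigma> \<noteq> {} \<and> (\<forall>\<tau>. \<tau> \<subseteq> \<sigma> \<and> \<tau> \<noteq> {} \<longrightarrow> \<tau> \<in> K))"

definition vertices :: "'v set set \<Rightarrow> 'v set" where
  "vertices K = \<Union>K"

definition full_subcomplex :: "'v set set \<Rightarrow> 'v set \<Rightarrow> 'v set set" where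
  "full_subcomplex K I = {\<sigma> \<in> K. \<sigma> \<subseteq> I}"

definition connected_complex :: "'v set set \<Rightarrow> bool" where
  "connected_complex K \<longleftrightarrow>
     (\<forall>u\<in>vertices K. \<forall>w\<in>vertices K. (u, w) \<in> {(x, y). {x, y} \<in> K}\<^sup>*)"

text \<open>The sign of the face \<open>\<sigma> - {v}\<close> in the simplicial boundary of \<open>\<sigma>\<close>.\<close>

definition face_sign :: "'v::linorder set \<Rightarrow> 'v \<Rightarrow> int" where
  "face_sign \<sigma> v = (-1) ^ card {u \<in> \<sigma>. u < v}"


section \<open>Homology of complexes of abelian groups\<close>

text \<open>The homology at \<open>B\<close> of \<open>A \<rightarrow> B \<rightarrow> C\<close>, with maps \<open>f\<close> and \<open>g\<close>.\<close>

definition homology_at ::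
  "'a monoid \<Rightarrow> ('a \<Rightarrow> 'b) \<Rightarrow> 'b monoid \<Rightarrow> ('b \<Rightarrow> 'c) \<Rightarrow> 'c monoid \<Rightarrow> 'b set monoid" where
  "homology_at A f B g C = subgroup_generated B (kernel B C g) Mod (f ` carrier A)"

text \<open>
  The map into a quotient of \<open>G\<close> by \<open>N\<close> induced by \<open>f\<close>. If \<open>f\<close> is compatible with the
  quotients, all cosets in the union coincide, and the value at the coset of \<open>x\<close> is the
  coset of \<open>f x\<close>.
\<close>

definition quotient_map :: "'b monoid \<Rightarrow> 'b set \<Rightarrow> ('a \<Rightarrow> 'b) \<Rightarrow> 'a set \<Rightarrow> 'b set" where
  "quotient_map G N f X = (\<Union>x\<in>X. N #>\<^bsub>G\<^esub> f x)"


section \<open>Ueberhomology\<close>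

definition bicolourings :: "'v set set \<Rightarrow> ('v \<Rightarrow> nat) set" where
  "bicolourings K = vertices K \<rightarrow>\<^sub>E {0, 1}"

definition colour_length :: "'v set set \<Rightarrow> ('v \<Rightarrow> nat) \<Rightarrow> nat" where
  "colour_length K \<epsilon> = (\<Sum>v\<in>vertices K. \<epsilon> v)"

definition weight :: "('v \<Rightarrow> nat) \<Rightarrow> 'v set \<Rightarrow> nat" where
  "weight \<epsilon> \<sigma> = card {v \<in> \<sigma>. \<epsilon> v = 0}"

text \<open>Chains of weight \<open>k\<close> and simplex dimension \<open>i\<close>.\<close>

definition hor_chain_group ::
  "'v set set \<Rightarrow> ('v \<Rightarrow> nat) \<Rightarrow> nat \<Rightarrow> int \<Rightarrow> ('v set \<Rightarrow>\<^sub>0 int) monoid" where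
  "hor_chain_group K \<epsilon> k i =
     free_Abelian_group {\<sigma> \<in> K. weight \<epsilon> \<sigma> = k \<and> int (card \<sigma>) = i + 1}"

text \<open>
  The weight-preserving part of the simplicial differential. The condition
  \<open>\<sigma> - {v} \<in> K\<close> only excludes the empty face of a vertex.
\<close>

definition hor_boundary ::
  "'v::linorder set set \<Rightarrow> ('v \<Rightarrow> nat) \<Rightarrow> ('v set \<Rightarrow>\<^sub>0 int) \<Rightarrow> ('v set \<Rightarrow>\<^sub>0 int)" where
  "hor_boundary K \<epsilon> = frag_extend (\<lambda>\<sigma>.
     \<Sum>v | v \<in> \<sigma> \<and> \<sigma> - {v} \<in> K \<and> weight \<epsilon> (\<sigma> - {v}) = weight \<epsilon> \<sigma>.
       frag_cmul (face_sign \<sigma> v) (frag_of (\<sigma> - {v})))"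

definition hor_homology ::
  "'v::linorder set set \<Rightarrow> ('v \<Rightarrow> nat) \<Rightarrow> nat \<Rightarrow> int \<Rightarrow> ('v set \<Rightarrow>\<^sub>0 int) set monoid" where
  "hor_homology K \<epsilon> k i =
     homology_at (hor_chain_group K \<epsilon> k (i + 1)) (hor_boundary K \<epsilon>)
       (hor_chain_group K \<epsilon> k i) (hor_boundary K \<epsilon>) (hor_chain_group K \<epsilon> k (i - 1))"

text \<open>
  The component \<open>d\<^bsub>\<epsilon>,\<epsilon>'\<^esub>\<close> in weight \<open>k\<close> and simplex dimension \<open>i\<close>, where \<open>\<epsilon>\<close> and
  \<open>\<epsilon>'\<close> differ only at \<open>v\<close>, with \<open>\<epsilon> v = 0\<close> and \<open>\<epsilon>' v = 1\<close>.
\<close>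

definition uber_component ::
  "'v::linorder set set \<Rightarrow> nat \<Rightarrow> int \<Rightarrow> 'v \<Rightarrow> ('v \<Rightarrow> nat) \<Rightarrow> ('v \<Rightarrow> nat) \<Rightarrow>
     ('v set \<Rightarrow>\<^sub>0 int) set \<Rightarrow> ('v set \<Rightarrow>\<^sub>0 int) set" where
  "uber_component K k i v \<epsilon> \<epsilon>' =
     quotient_map (hor_chain_group K \<epsilon>' k i)
       (hor_boundary K \<epsilon>' ` carrier (hor_chain_group K \<epsilon>' k (i + 1)))
       (frag_extend (\<lambda>\<sigma>. if weight \<epsilon> \<sigma> = weight \<epsilon>' \<sigma>
          then frag_cmul ((-1) ^ card {u \<in> vertices K. u < v \<and> \<epsilon> u = 1}) (frag_of \<sigma>)
          else 0))"

definition uber_chain_group ::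
  "'v::linorder set set \<Rightarrow> int \<Rightarrow> nat \<Rightarrow> int \<Rightarrow>
     (('v \<Rightarrow> nat) \<Rightarrow> ('v set \<Rightarrow>\<^sub>0 int) set) monoid" where
  "uber_chain_group K j k i =
     sum_group {\<epsilon> \<in> bicolourings K. int (colour_length K \<epsilon>) = j} (\<lambda>\<epsilon>. hor_homology K \<epsilon> k i)"

text \<open>
  The bicolourings \<open>\<epsilon>\<close> with a component into \<open>\<epsilon>'\<close> are the \<open>\<epsilon>'(v := 0)\<close> with
  \<open>\<epsilon>' v = 1\<close>.
\<close>

definition uber_diff ::
  "'v::linorder set set \<Rightarrow> int \<Rightarrow> nat \<Rightarrow> int \<Rightarrow>
     (('v \<Rightarrow> nat) \<Rightarrow> ('v set \<Rightarrow>\<^sub>0 int) set) \<Rightarrow> ('v \<Rightarrow> nat) \<Rightarrow> ('v set \<Rightarrow>\<^sub>0 int) set" where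
  "uber_diff K j k i x =
     (\<lambda>\<epsilon>' \<in> {\<epsilon>' \<in> bicolourings K. int (colour_length K \<epsilon>') = j + 1}.
        finprod (hor_homology K \<epsilon>' k i)
          (\<lambda>v. uber_component K k i v (\<epsilon>'(v := 0)) \<epsilon>' (x (\<epsilon>'(v := 0))))
          {v \<in> vertices K. \<epsilon>' v = 1})"

definition uberhomology ::
  "'v::linorder set set \<Rightarrow> int \<Rightarrow> nat \<Rightarrow> int \<Rightarrow>
     (('v \<Rightarrow> nat) \<Rightarrow> ('v set \<Rightarrow>\<^sub>0 int) set) set monoid" where
  "uberhomology K j k i =
     homology_at (uber_chain_group K (j - 1) k i) (uber_diff K (j - 1) k i)
       (uber_chain_group K j k i) (uber_diff K j k i) (uber_chain_group K (j + 1) k i)"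

definition zero_degree_uberhomology ::
  "'v::linorder set set \<Rightarrow> int \<Rightarrow> int \<Rightarrow>
     (('v \<Rightarrow> nat) \<Rightarrow> ('v set \<Rightarrow>\<^sub>0 int) set) set monoid" where
  "zero_degree_uberhomology K j i = uberhomology K j 0 i"


section \<open>Double homology of moment-angle complexes\<close>

text \<open>Augmented chains: the empty simplex has dimension \<open>-1\<close>.\<close>

definition aug_chain_group :: "'v set set \<Rightarrow> int \<Rightarrow> ('v set \<Rightarrow>\<^sub>0 int) monoid" where
  "aug_chain_group L p = free_Abelian_group {\<sigma> \<in> insert {} L. int (card \<sigma>) = p + 1}"

definition aug_boundary :: "('v::linorder set \<Rightarrow>\<^sub>0 int) \<Rightarrow> ('v set \<Rightarrow>\<^sub>0 int)" where
  "aug_boundary = frag_extend (\<lambda>\<sigma>.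
     \<Sum>v\<in>\<sigma>. frag_cmul (face_sign \<sigma> v) (frag_of (\<sigma> - {v})))"

definition reduced_homology ::
  "'v::linorder set set \<Rightarrow> int \<Rightarrow> ('v set \<Rightarrow>\<^sub>0 int) set monoid" where
  "reduced_homology L p =
     homology_at (aug_chain_group L (p + 1)) aug_boundary
       (aug_chain_group L p) aug_boundary (aug_chain_group L (p - 1))"

text \<open>
  The map from the \<open>p\<close>-th reduced homology of a subcomplex of \<open>L\<close> to that of \<open>L\<close> induced by
  inclusion.
\<close>

definition inclusion_map ::
  "'v::linorder set set \<Rightarrow> int \<Rightarrow> ('v set \<Rightarrow>\<^sub>0 int) set \<Rightarrow> ('v set \<Rightarrow>\<^sub>0 int) set" where
  "inclusion_map L p =
     quotient_map (aug_chain_group L p) (aug_boundary ` carrier (aug_chain_group L (p + 1))) id"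

text \<open>
  The group in bidegree \<open>(a, b) = (-k, 2l)\<close>, where \<open>l - k - 1 = l + a - 1\<close>. The index set is
  empty, and hence the group trivial, if \<open>b\<close> is odd or negative.
\<close>

definition moment_angle_homology ::
  "'v::linorder set set \<Rightarrow> int \<Rightarrow> int \<Rightarrow> ('v set \<Rightarrow> ('v set \<Rightarrow>\<^sub>0 int) set) monoid" where
  "moment_angle_homology K a b =
     sum_group {I. I \<subseteq> vertices K \<and> 2 * int (card I) = b}
       (\<lambda>I. reduced_homology (full_subcomplex K I) (int (card I) + a - 1))"

text \<open>
  The differential from bidegree \<open>(a, b)\<close> to bidegree \<open>(a - 1, b + 2)\<close>. Its component at \<open>J\<close>
  collects the contributions of the \<open>I = J - {j}\<close> with \<open>j \<in> J\<close>.
\<close>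

definition double_diff ::
  "'v::linorder set set \<Rightarrow> int \<Rightarrow> int \<Rightarrow>
     ('v set \<Rightarrow> ('v set \<Rightarrow>\<^sub>0 int) set) \<Rightarrow> 'v set \<Rightarrow> ('v set \<Rightarrow>\<^sub>0 int) set" where
  "double_diff K a b x =
     (\<lambda>J \<in> {J. J \<subseteq> vertices K \<and> 2 * int (card J) = b + 2}.
        let p = b div 2 + a - 1; H = reduced_homology (full_subcomplex K J) p
        in finprod H
             (\<lambda>j. let I = J - {j}
                  in inclusion_map (full_subcomplex K J) p (x I)
                       [^]\<^bsub>H\<^esub> ((-1) ^ nat \<bar>p + 1\<bar> * (-1) ^ card {i \<in> I. i < j} :: int))
             J)"

definition double_homology ::
  "'v::linorder set set \<Rightarrow> int \<Rightarrow> int \<Rightarrow> ('v set \<Rightarrow> ('v set \<Rightarrow>\<^sub>0 int) set) set monoid" where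
  "double_homology K a b =
     homology_at (moment_angle_homology K (a + 1) (b - 2)) (double_diff K (a + 1) (b - 2))
       (moment_angle_homology K a b) (double_diff K a b) (moment_angle_homology K (a - 1) (b + 2))"

end

theory Submission
  imports Defs
begin

text \<open>
  Weight \<open>0\<close> simplices for the bicolouring with support \<open>I\<close> are the simplices of \<open>K[I]\<close>. Away from
  degrees \<open>0\<close> and \<open>-1\<close> the augmentation does not affect homology, so the group attached to this
  bicolouring is the reduced homology of \<open>K[I]\<close>. Under the bijection between bicolourings and their
  supports the two complexes thus have the same groups, and their differentials agree up to the
  global sign \<open>(-1)\<^sup>i\<^sup>+\<^sup>1\<close>, which changes neither kernels nor images.
\<close>

section \<open>Simplicial chains\<close>

text \<open>The two groups attached to a vertex set are shown to be the same monoid of cosets of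
  chains, not merely isomorphic ones. The comparison map of the outer complexes therefore only
  renames indices, and the work lies in matching the differentials. On one side a sign multiplies
  chains, on the other it is an exponent in a homology group. To pass between the two, cycles modulo
  boundaries must really form an abelian group; this is what the square-zero property of
  \<open>aug_boundary\<close> is for. For the outer complexes a lighter route suffices:
  \<open>homology_at\<close> makes sense for arbitrary maps, so it is enough that images and kernels
  correspond, and no square-zero property enters there. The discrepancy in sign is global because in
  bidegree \<open>(i - j + 1, 2 * j)\<close> every summand has degree
  \<open>j + (i - j + 1) - 1 = i\<close>, so that \<open>(-1)^(p + 1)\<close> does not vary with the
  vertex set.\<close>

lemma aug_boundary_of:
  "aug_boundary (frag_of \<sigma>) = (\<Sum>v\<in>\<sigma>. frag_cmul (face_sign \<sigma> v) (frag_of (\<sigma> - {v})))"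
  by (simp add: aug_boundary_def)

text \<open>Deleting the smaller vertex \<open>w\<close> lowers the position of \<open>v\<close> by
  one, while deleting \<open>v\<close> leaves the position of \<open>w\<close> unchanged. Exactly
  one sign flips.\<close>

lemma face_sign_swap:
  assumes "finite \<sigma>" "v \<in> \<sigma>" "w \<in> \<sigma>" "w < v"
  shows "face_sign \<sigma> w * face_sign (\<sigma> - {w}) v = - (face_sign \<sigma> v * face_sign (\<sigma> - {v}) w)"
proof -
  have "{u \<in> \<sigma>. u < v} = insert w {u \<in> \<sigma> - {w}. u < v}"
    using assms by auto
  moreover have "card (insert w {u \<in> \<sigma> - {w}. u < v}) = Suc (card {u \<in> \<sigma> - {w}. u < v})"
    by (rule card_insert_disjoint) (use assms(1) in auto)
  ultimately have v: "card {u \<in> \<sigma>. u < v} = Suc (card {u \<in> \<sigma> - {w}. u < v})"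
    by (rule ssubst)
  have w: "{u \<in> \<sigma> - {v}. u < w} = {u \<in> \<sigma>. u < w}"
    using less_not_sym[OF assms(4)] by blast
  show ?thesis
    unfolding face_sign_def v w power_Suc by simp
qed

lemma aug_boundary_boundary_of:
  assumes "finite \<sigma>"
  shows "aug_boundary (aug_boundary (frag_of \<sigma>)) = 0"
proof -
  define F where "F v w = frag_cmul (face_sign \<sigma> v * face_sign (\<sigma> - {v}) w) (frag_of (\<sigma> - {v} - {w}))" for v w
  have anti: "F w v = - F v w" if "v \<in> \<sigma>" "w \<in> \<sigma>" "v \<noteq> w" for v w
  proof -
    have faces: "\<sigma> - {w} - {v} = \<sigma> - {v} - {w}" by auto
    have sign: "face_sign \<sigma> w * face_sign (\<sigma> - {w}) v = - (face_sign \<sigma> v * face_sign (\<sigma> - {v}) w)"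
    proof (cases "w < v")
      case True
      show ?thesis
        by (rule face_sign_swap[OF assms that(1,2) True])
    next
      case False
      then have "v < w" using that by simp
      from face_sign_swap[OF assms that(2,1) this] show ?thesis by simp
    qed
    show ?thesis
      unfolding F_def faces sign by simp
  qed
  define P where "P = (SIGMA v:\<sigma>. \<sigma> - {v})"
  define S where "S = (\<Sum>p\<in>P. F (fst p) (snd p))"
  have "aug_boundary (aug_boundary (frag_of \<sigma>)) = (\<Sum>v\<in>\<sigma>. \<Sum>w\<in>\<sigma> - {v}. F v w)"
    unfolding aug_boundary_of
    unfolding aug_boundary_def
    by (simp add: frag_extend_sum[OF assms] frag_extend_cmul frag_cmul_sum F_def o_def)
  also have "\<dots> = S"
    unfolding S_def P_def using assms by (simp add: sum.Sigma case_prod_beta)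
  finally have eq: "aug_boundary (aug_boundary (frag_of \<sigma>)) = S" .
  \<comment> \<open>Each codimension-two face arises from two ordered pairs of vertices. Exchanging
    the entries of a pair permutes \<open>P\<close> and, by antisymmetry of \<open>F\<close>,
    negates every term.\<close>
  have "S = (\<Sum>p\<in>P. F (snd p) (fst p))"
    unfolding S_def
    by (rule sum.reindex_bij_witness[where i = prod.swap and j = prod.swap]) (auto simp: P_def)
  also have "\<dots> = (\<Sum>p\<in>P. - F (fst p) (snd p))"
  proof (rule sum.cong[OF refl])
    show "F (snd p) (fst p) = - F (fst p) (snd p)" if "p \<in> P" for p
      by (rule anti) (use that P_def in auto)
  qed
  also have "\<dots> = - S"
    by (simp only: sum_negf S_def)
  finally have "S = - S" .
  \<comment> \<open>\<open>S = - S\<close> forces \<open>S = 0\<close> because the coefficients are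
    integers; this is read off coefficient by coefficient.\<close>
  from arg_cong[OF this, of "\<lambda>c. poly_mapping.lookup c _"]
  have neg: "poly_mapping.lookup S \<tau> = - poly_mapping.lookup S \<tau>" for \<tau>
    unfolding lookup_uminus .
  have "S = 0"
  proof (rule poly_mapping_eqI)
    show "poly_mapping.lookup S \<tau> = poly_mapping.lookup 0 \<tau>" for \<tau>
      unfolding lookup_zero using neg[of \<tau>] by linarith
  qed
  with eq show ?thesis by (rule trans)
qed

lemma aug_boundary_boundary:
  assumes "\<And>\<sigma>. \<sigma> \<in> Poly_Mapping.keys c \<Longrightarrow> finite \<sigma>"
  shows "aug_boundary (aug_boundary c) = 0"
proof -
  have "Poly_Mapping.keys c \<subseteq> {\<sigma>. finite \<sigma>}" using assms by auto
  then show ?thesis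
  proof (induction c rule: frag_induction)
    case zero
    then show ?case by (simp add: aug_boundary_def)
  next
    case (one \<sigma>)
    then show ?case by (simp add: aug_boundary_boundary_of)
  next
    case (diff a b)
    then show ?case by (simp add: aug_boundary_def frag_extend_diff)
  qed
qed

lemma simplicial_complex_finite:
  "simplicial_complex L \<Longrightarrow> \<sigma> \<in> insert {} L \<Longrightarrow> finite \<sigma>"
  unfolding simplicial_complex_def by blast

lemma simplicial_complex_face:
  "simplicial_complex L \<Longrightarrow> \<sigma> \<in> L \<Longrightarrow> \<tau> \<subseteq> \<sigma> \<Longrightarrow> \<tau> \<in> insert {} L"
  unfolding simplicial_complex_def by blast

lemma simplicial_complex_full_subcomplex:
  "simplicial_complex K \<Longrightarrow> simplicial_complex (full_subcomplex K I)"
  unfolding simplicial_complex_def full_subcomplex_def by blast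

lemma carrier_aug_chain_group:
  "carrier (aug_chain_group L p) = {c. Poly_Mapping.keys c \<subseteq> {\<sigma> \<in> insert {} L. int (card \<sigma>) = p + 1}}"
  by (auto simp: aug_chain_group_def)

lemma one_aug_chain_group [simp]: "\<one>\<^bsub>aug_chain_group L p\<^esub> = 0"
  by (simp add: aug_chain_group_def)

lemma mult_aug_chain_group [simp]: "c \<otimes>\<^bsub>aug_chain_group L p\<^esub> d = c + d"
  by (simp add: aug_chain_group_def)

lemma comm_group_aug_chain_group [simp]: "comm_group (aug_chain_group L p)"
  by (simp add: aug_chain_group_def abelian_free_Abelian_group)

lemma group_aug_chain_group [simp]: "group (aug_chain_group L p)"
  by (rule comm_group.axioms(2)) simp

lemma int_pow_aug_chain_group:
  "c \<in> carrier (aug_chain_group L p) \<Longrightarrow> c [^]\<^bsub>aug_chain_group L p\<^esub> (n::int) = frag_cmul n c"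
  by (simp add: aug_chain_group_def)

lemma kernel_aug_boundary:
  "kernel (aug_chain_group L p) (aug_chain_group M q) aug_boundary
    = {c \<in> carrier (aug_chain_group L p). aug_boundary c = 0}"
  by (simp add: kernel_def)

lemma aug_boundary_closed:
  assumes L: "simplicial_complex L" and "c \<in> carrier (aug_chain_group L p)"
  shows "aug_boundary c \<in> carrier (aug_chain_group L (p - 1))"
proof -
  let ?T = "{\<sigma> \<in> insert {} L. int (card \<sigma>) = p - 1 + 1}"
  have "Poly_Mapping.keys (aug_boundary c) \<subseteq> ?T"
    using assms(2) unfolding carrier_aug_chain_group mem_Collect_eq
  proof (induction c rule: frag_induction)
    case zero
    then show ?case by (simp add: aug_boundary_def)
  next
    case (one \<sigma>)
    have fin: "finite \<sigma>" using one simplicial_complex_finite[OF L] by blast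
    have "\<sigma> - {v} \<in> ?T" if v: "v \<in> \<sigma>" for v
    proof -
      \<comment> \<open>A simplex with a vertex is not the added empty one. Its face may be empty,
        and then it is a generator in degree -1.\<close>
      have "\<sigma> \<in> L" using one v by auto
      then have "\<sigma> - {v} \<in> insert {} L"
        by (rule simplicial_complex_face[OF L]) blast
      moreover have "card \<sigma> = Suc (card (\<sigma> - {v}))"
        using fin v by (rule card.remove)
      ultimately show ?thesis
        using one by simp
    qed
    then have "Poly_Mapping.keys (frag_cmul (face_sign \<sigma> v) (frag_of (\<sigma> - {v}))) \<subseteq> ?T" if "v \<in> \<sigma>" for v
      using that by (intro order_trans[OF keys_cmul]) simp
    then show ?case
      unfolding aug_boundary_of by (intro order_trans[OF keys_sum] UN_least)
  next
    case (diff a b)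
    then show ?case
      unfolding aug_boundary_def frag_extend_diff by (intro order_trans[OF keys_diff] Un_least)
  qed
  then show ?thesis
    unfolding carrier_aug_chain_group by blast
qed

lemma aug_boundary_hom:
  assumes "simplicial_complex L"
  shows "aug_boundary \<in> hom (aug_chain_group L p) (aug_chain_group L (p - 1))"
  using aug_boundary_closed[OF assms]
  by (intro homI) (simp_all add: aug_boundary_def frag_extend_add)

section \<open>Homology of three-term complexes\<close>

text \<open>Commutativity of \<open>B\<close> makes the boundaries normal in the cycles, and
  \<open>g_f\<close> puts them inside the cycles, so \<open>homology_at\<close> is a genuine abelian
  group. The locale serves the augmented chain complexes, not the complexes formed from their
  homology groups.\<close>

locale three_term_complex =
  A: group A + B: comm_group B + C: group C
  for A :: "'a monoid" and B :: "'b monoid" and C :: "'c monoid" +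
  fixes f :: "'a \<Rightarrow> 'b" and g :: "'b \<Rightarrow> 'c"
  assumes f_hom: "f \<in> hom A B" and g_hom: "g \<in> hom B C"
    and g_f: "\<And>a. a \<in> carrier A \<Longrightarrow> g (f a) = \<one>\<^bsub>C\<^esub>"
begin

abbreviation "cycles \<equiv> kernel B C g"
abbreviation "boundaries \<equiv> f ` carrier A"
abbreviation "H \<equiv> homology_at A f B g C"

lemma subgroup_cycles: "subgroup cycles B"
  using g_hom by (intro group_hom.subgroup_kernel) (simp add: group_hom_def group_hom_axioms_def)

lemma subgroup_boundaries: "subgroup boundaries B"
  using f_hom by (intro group_hom.img_is_subgroup) (simp add: group_hom_def group_hom_axioms_def)

lemma boundaries_subset: "boundaries \<subseteq> cycles"
  using f_hom by (auto simp: kernel_def g_f hom_def)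

lemma subgroup_boundaries_cycles: "subgroup boundaries (subgroup_generated B cycles)"
  using boundaries_subset subgroup_boundaries by (rule B.subgroup_of_subgroup_generated)

lemma normal_boundaries: "boundaries \<lhd> subgroup_generated B cycles"
  using subgroup_boundaries_cycles
  by (intro comm_group.subgroup_imp_normal B.abelian_subgroup_generated) (rule B.comm_group_axioms)

lemma comm_group_homology: "comm_group H"
  unfolding homology_at_def
  by (intro comm_group.abelian_FactGroup subgroup_boundaries_cycles
      B.abelian_subgroup_generated B.comm_group_axioms)

text \<open>A coset involves only the multiplication, which the group of cycles inherits from
  \<open>B\<close>. Hence cosets can be written in \<open>B\<close> itself, which gives classes in
  different subcomplexes a uniform shape.\<close>

lemma carrier_homology: "carrier H = (\<lambda>c. boundaries #>\<^bsub>B\<^esub> c) ` cycles"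
  by (simp add: homology_at_def carrier_FactGroup r_coset_def
      subgroup.carrier_subgroup_generated_subgroup[OF subgroup_cycles])

lemma coset_hom: "(\<lambda>c. boundaries #>\<^bsub>B\<^esub> c) \<in> hom (subgroup_generated B cycles) H"
  using normal.r_coset_hom_Mod[OF normal_boundaries]
  by (simp add: homology_at_def r_coset_def)

lemma coset_mult:
  assumes "c \<in> cycles" "d \<in> cycles"
  shows "(boundaries #>\<^bsub>B\<^esub> c) \<otimes>\<^bsub>H\<^esub> (boundaries #>\<^bsub>B\<^esub> d) = boundaries #>\<^bsub>B\<^esub> (c \<otimes>\<^bsub>B\<^esub> d)"
  using hom_mult[OF coset_hom, of c d] assms
  by (simp add: subgroup.carrier_subgroup_generated_subgroup[OF subgroup_cycles])

lemma coset_int_pow: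
  assumes "c \<in> cycles"
  shows "(boundaries #>\<^bsub>B\<^esub> c) [^]\<^bsub>H\<^esub> (n::int) = boundaries #>\<^bsub>B\<^esub> (c [^]\<^bsub>B\<^esub> n)"
proof -
  have c: "c \<in> carrier (subgroup_generated B cycles)"
    using assms by (simp add: subgroup.carrier_subgroup_generated_subgroup[OF subgroup_cycles])
  have "boundaries #>\<^bsub>B\<^esub> (c [^]\<^bsub>subgroup_generated B cycles\<^esub> n) = (boundaries #>\<^bsub>B\<^esub> c) [^]\<^bsub>H\<^esub> n"
    using hom_int_pow[OF coset_hom c] comm_group_homology
    by (simp add: comm_group_def)
  then show ?thesis
    by (simp add: B.int_pow_subgroup_generated[OF c])
qed

end

text \<open>The representatives of the coset are \<open>h \<otimes> c\<close> with
  \<open>h \<in> N\<close>, and \<open>f h\<close> is absorbed by \<open>N'\<close>. All members of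
  the union in \<open>quotient_map\<close> are thus the same coset, and the union is nonempty
  because \<open>N\<close> contains the neutral element.\<close>

lemma quotient_map_coset:
  assumes "group G" "comm_group G'" "subgroup N G" "subgroup N' G'"
    and "f \<in> hom G G'" "f ` N \<subseteq> N'" "c \<in> carrier G"
  shows "quotient_map G' N' f (N #>\<^bsub>G\<^esub> c) = N' #>\<^bsub>G'\<^esub> f c"
proof -
  interpret G: group G by fact
  interpret G': comm_group G' by fact
  interpret N: subgroup N G by fact
  interpret N': subgroup N' G' by fact
  have fc: "f c \<in> carrier G'" using assms by (auto simp: hom_def)
  have "N' #>\<^bsub>G'\<^esub> f (h \<otimes>\<^bsub>G\<^esub> c) = N' #>\<^bsub>G'\<^esub> f c" if "h \<in> N" for h
  proof -
    have fh: "f h \<in> N'" using that assms by auto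
    have "f (h \<otimes>\<^bsub>G\<^esub> c) = f h \<otimes>\<^bsub>G'\<^esub> f c"
      using that assms by (simp add: hom_mult)
    then have "N' #>\<^bsub>G'\<^esub> f (h \<otimes>\<^bsub>G\<^esub> c) = (N' #>\<^bsub>G'\<^esub> f h) #>\<^bsub>G'\<^esub> f c"
      using fh fc by (simp add: G'.coset_mult_assoc N'.subset)
    then show ?thesis
      using fh assms(4) by (simp add: G'.coset_join2)
  qed
  moreover have "N #>\<^bsub>G\<^esub> c = (\<lambda>h. h \<otimes>\<^bsub>G\<^esub> c) ` N"
    by (auto simp: r_coset_def)
  moreover have "N \<noteq> {}"
    using N.one_closed by blast
  ultimately show ?thesis
    by (simp add: quotient_map_def)
qed

lemma quotient_map_cong:
  "(\<And>x. x \<in> X \<Longrightarrow> f x = f' x) \<Longrightarrow> quotient_map G N f X = quotient_map G N f' X"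
  by (simp add: quotient_map_def)

section \<open>Reduced homology and inclusions\<close>

lemma three_term_complex_aug:
  assumes "simplicial_complex L"
  shows "three_term_complex (aug_chain_group L (p + 1)) (aug_chain_group L p) (aug_chain_group L (p - 1))
           aug_boundary aug_boundary"
proof (intro three_term_complex.intro three_term_complex_axioms.intro)
  show "aug_boundary \<in> hom (aug_chain_group L (p + 1)) (aug_chain_group L p)"
    using aug_boundary_hom[OF assms, of "p + 1"] by simp
  show "aug_boundary (aug_boundary c) = \<one>\<^bsub>aug_chain_group L (p - 1)\<^esub>"
    if "c \<in> carrier (aug_chain_group L (p + 1))" for c
  proof -
    have "finite \<sigma>" if "\<sigma> \<in> Poly_Mapping.keys c" for \<sigma>
      using that \<open>c \<in> _\<close> simplicial_complex_finite[OF assms]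
      unfolding carrier_aug_chain_group by blast
    then show ?thesis
      by (simp add: aug_boundary_boundary)
  qed
qed (simp_all add: aug_boundary_hom[OF assms])

lemma comm_group_reduced_homology:
  "simplicial_complex L \<Longrightarrow> comm_group (reduced_homology L p)"
  unfolding reduced_homology_def
  by (rule three_term_complex.comm_group_homology) (rule three_term_complex_aug)

lemma aug_chain_group_mono:
  "L \<subseteq> M \<Longrightarrow> carrier (aug_chain_group L p) \<subseteq> carrier (aug_chain_group M p)"
  unfolding carrier_aug_chain_group by (rule Collect_mono) blast

lemma reduced_homologyE:
  assumes "simplicial_complex L" "X \<in> carrier (reduced_homology L p)"
  obtains c where "c \<in> carrier (aug_chain_group L p)" "aug_boundary c = 0"
    "X = aug_boundary ` carrier (aug_chain_group L (p + 1)) #>\<^bsub>aug_chain_group L p\<^esub> c"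
proof -
  interpret three_term_complex "aug_chain_group L (p + 1)" "aug_chain_group L p" "aug_chain_group L (p - 1)"
    aug_boundary aug_boundary
    by (rule three_term_complex_aug[OF assms(1)])
  obtain c where "X = boundaries #>\<^bsub>aug_chain_group L p\<^esub> c" "c \<in> cycles"
    using assms(2) unfolding reduced_homology_def carrier_homology by blast
  then show thesis
    unfolding kernel_aug_boundary by (intro that) simp_all
qed

text \<open>One computation for two maps: \<open>n = 1\<close> is the inclusion, and
  \<open>n = \<plusminus>1\<close> is a component of the ueber differential. It converts an integer
  factor on chains into an exponent in homology, the form in which signs occur in
  \<open>double_diff\<close>.\<close>

lemma reduced_homology_mult_map:
  assumes L: "simplicial_complex L" and M: "simplicial_complex M" and "L \<subseteq> M"
    and c: "c \<in> carrier (aug_chain_group L p)" "aug_boundary c = 0"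
  shows "quotient_map (aug_chain_group M p) (aug_boundary ` carrier (aug_chain_group M (p + 1))) (frag_cmul n)
           (aug_boundary ` carrier (aug_chain_group L (p + 1)) #>\<^bsub>aug_chain_group L p\<^esub> c)
         = (aug_boundary ` carrier (aug_chain_group M (p + 1)) #>\<^bsub>aug_chain_group M p\<^esub> c)
             [^]\<^bsub>reduced_homology M p\<^esub> n"
proof -
  interpret L: three_term_complex "aug_chain_group L (p + 1)" "aug_chain_group L p" "aug_chain_group L (p - 1)"
    aug_boundary aug_boundary
    using L by (rule three_term_complex_aug)
  interpret M: three_term_complex "aug_chain_group M (p + 1)" "aug_chain_group M p" "aug_chain_group M (p - 1)"
    aug_boundary aug_boundary
    using M by (rule three_term_complex_aug)
  note mono = aug_chain_group_mono[OF \<open>L \<subseteq> M\<close>]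
  have cM: "c \<in> carrier (aug_chain_group M p)" using c mono by auto
  have pow: "x [^]\<^bsub>aug_chain_group M q\<^esub> n = frag_cmul n x" if "x \<in> carrier (aug_chain_group M q)" for x q
    using that by (rule int_pow_aug_chain_group)
  have "frag_cmul n \<in> hom (aug_chain_group L p) (aug_chain_group M p)"
  proof (rule homI)
    fix x assume "x \<in> carrier (aug_chain_group L p)"
    then have x: "x \<in> carrier (aug_chain_group M p)" using mono by auto
    show "frag_cmul n x \<in> carrier (aug_chain_group M p)"
      using M.B.int_pow_closed[OF x, of n] pow[OF x] by simp
  qed (simp add: frag_cmul_distrib2)
  moreover have "frag_cmul n ` L.boundaries \<subseteq> M.boundaries"
  proof clarify
    fix x assume "x \<in> carrier (aug_chain_group L (p + 1))"
    then have x: "x \<in> carrier (aug_chain_group M (p + 1))" using mono by auto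
    have "frag_cmul n (aug_boundary x) = aug_boundary (frag_cmul n x)"
      by (simp add: aug_boundary_def frag_extend_cmul)
    moreover have "frag_cmul n x \<in> carrier (aug_chain_group M (p + 1))"
      using M.A.int_pow_closed[OF x, of n] pow[OF x] by simp
    ultimately show "frag_cmul n (aug_boundary x) \<in> M.boundaries" by simp
  qed
  ultimately have "quotient_map (aug_chain_group M p) M.boundaries (frag_cmul n)
     (L.boundaries #>\<^bsub>aug_chain_group L p\<^esub> c) = M.boundaries #>\<^bsub>aug_chain_group M p\<^esub> frag_cmul n c"
    using c by (intro quotient_map_coset L.B.group_axioms M.B.comm_group_axioms
        L.subgroup_boundaries M.subgroup_boundaries)
  also have "\<dots> = (M.boundaries #>\<^bsub>aug_chain_group M p\<^esub> c) [^]\<^bsub>M.H\<^esub> n"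
    using M.coset_int_pow[of c n] cM c by (simp add: kernel_aug_boundary pow)
  finally show ?thesis by (simp add: reduced_homology_def)
qed

lemma inclusion_map_coset:
  assumes "simplicial_complex L" and M: "simplicial_complex M" and "L \<subseteq> M"
    and c: "c \<in> carrier (aug_chain_group L p)" "aug_boundary c = 0"
  shows "inclusion_map M p (aug_boundary ` carrier (aug_chain_group L (p + 1)) #>\<^bsub>aug_chain_group L p\<^esub> c)
         = aug_boundary ` carrier (aug_chain_group M (p + 1)) #>\<^bsub>aug_chain_group M p\<^esub> c" (is ?eq)
    and "inclusion_map M p (aug_boundary ` carrier (aug_chain_group L (p + 1)) #>\<^bsub>aug_chain_group L p\<^esub> c)
         \<in> carrier (reduced_homology M p)" (is ?mem)
proof -
  interpret M: three_term_complex "aug_chain_group M (p + 1)" "aug_chain_group M p" "aug_chain_group M (p - 1)"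
    aug_boundary aug_boundary
    using M by (rule three_term_complex_aug)
  interpret H: comm_group "reduced_homology M p"
    using M by (rule comm_group_reduced_homology)
  have mem: "M.boundaries #>\<^bsub>aug_chain_group M p\<^esub> c \<in> carrier (reduced_homology M p)"
    using c aug_chain_group_mono[OF \<open>L \<subseteq> M\<close>, of p]
    unfolding reduced_homology_def M.carrier_homology kernel_aug_boundary by auto
  have "(id :: _ \<Rightarrow> 'a set \<Rightarrow>\<^sub>0 int) = frag_cmul 1" by (auto simp: fun_eq_iff)
  then show ?eq
    using reduced_homology_mult_map[OF assms, of 1] mem by (simp add: inclusion_map_def)
  with mem show ?mem by simp
qed

lemma inclusion_map_hom:
  assumes L: "simplicial_complex L" and M: "simplicial_complex M" and LM: "L \<subseteq> M"
  shows "inclusion_map M p \<in> hom (reduced_homology L p) (reduced_homology M p)"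
proof (rule homI)
  fix X assume "X \<in> carrier (reduced_homology L p)"
  then show "inclusion_map M p X \<in> carrier (reduced_homology M p)"
    by (metis reduced_homologyE[OF L] inclusion_map_coset(2)[OF assms])
next
  interpret L: three_term_complex "aug_chain_group L (p + 1)" "aug_chain_group L p" "aug_chain_group L (p - 1)"
    aug_boundary aug_boundary
    using L by (rule three_term_complex_aug)
  interpret M: three_term_complex "aug_chain_group M (p + 1)" "aug_chain_group M p" "aug_chain_group M (p - 1)"
    aug_boundary aug_boundary
    using M by (rule three_term_complex_aug)
  note mono = aug_chain_group_mono[OF LM]
  fix X Y assume X: "X \<in> carrier (reduced_homology L p)" and Y: "Y \<in> carrier (reduced_homology L p)"
  obtain c where c: "c \<in> carrier (aug_chain_group L p)" "aug_boundary c = 0"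
    and Xc: "X = L.boundaries #>\<^bsub>aug_chain_group L p\<^esub> c"
    using X by (rule reduced_homologyE[OF L])
  obtain d where d: "d \<in> carrier (aug_chain_group L p)" "aug_boundary d = 0"
    and Yd: "Y = L.boundaries #>\<^bsub>aug_chain_group L p\<^esub> d"
    using Y by (rule reduced_homologyE[OF L])
  have cd: "c + d \<in> carrier (aug_chain_group L p)" "aug_boundary (c + d) = 0"
    using L.B.m_closed[OF c(1) d(1)] c d
    by (simp_all add: aug_boundary_def frag_extend_add)
  have Lm: "X \<otimes>\<^bsub>reduced_homology L p\<^esub> Y = L.boundaries #>\<^bsub>aug_chain_group L p\<^esub> (c + d)"
    unfolding reduced_homology_def Xc Yd
    using L.coset_mult[of c d] c d by (simp add: kernel_aug_boundary)
  have Mm: "inclusion_map M p X \<otimes>\<^bsub>reduced_homology M p\<^esub> inclusion_map M p Y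
      = M.boundaries #>\<^bsub>aug_chain_group M p\<^esub> (c + d)"
    unfolding Xc Yd inclusion_map_coset(1)[OF assms c] inclusion_map_coset(1)[OF assms d]
    unfolding reduced_homology_def
    using M.coset_mult[of c d] c d mono[of p] by (simp add: kernel_aug_boundary subset_iff)
  show "inclusion_map M p (X \<otimes>\<^bsub>reduced_homology L p\<^esub> Y)
      = inclusion_map M p X \<otimes>\<^bsub>reduced_homology M p\<^esub> inclusion_map M p Y"
    unfolding Lm Mm by (rule inclusion_map_coset(1)[OF assms cd])
qed

section \<open>Isomorphisms of complexes and reindexing of sums\<close>

lemma homology_at_iso:
  assumes "group B" "group B'" and h: "h \<in> iso B B'" and sub: "f ` carrier A \<subseteq> carrier B"
    and im: "h ` f ` carrier A = f' ` carrier A'" and ker: "h ` kernel B C g = kernel B' C' g'"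
  shows "homology_at A f B g C \<cong> homology_at A' f' B' g' C'"
proof -
  interpret h: group_hom B B' h
    using assms by (simp add: group_hom_def group_hom_axioms_def iso_def)
  define N where "N = f ` carrier A"
  define Z where "Z = carrier (subgroup_generated B (kernel B C g))"
  define Z' where "Z' = carrier (subgroup_generated B' (kernel B' C' g'))"
  have N: "N \<subseteq> carrier B" and N': "f' ` carrier A' = h ` N"
    using sub im by (auto simp: N_def)
  have Z: "Z \<subseteq> carrier B"
    unfolding Z_def by (rule h.G.carrier_subgroup_generated_subset)
  \<comment> \<open>As \<open>g\<close> is arbitrary, the kernel need not be a subgroup. What has to
    be matched are the generated subgroups, and \<open>h\<close> carries one to the other.\<close>
  have "kernel B C g \<subseteq> carrier B" by (auto simp: kernel_def)
  from h.iso_between_subgroups[OF h this ker] have hZ: "h ` Z = Z'"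
    by (simp add: Z_def Z'_def iso_def bij_betw_def)
  have inj: "inj_on h (carrier B)" using h by (simp add: iso_def bij_betw_def)
  have set_mult: "h ` (X <#>\<^bsub>B\<^esub> Y) = (h ` X) <#>\<^bsub>B'\<^esub> (h ` Y)" if "X \<subseteq> carrier B" "Y \<subseteq> carrier B" for X Y
  proof -
    have "h (x \<otimes>\<^bsub>B\<^esub> y) = h x \<otimes>\<^bsub>B'\<^esub> h y" if "x \<in> X" "y \<in> Y" for x y
      using that \<open>X \<subseteq> _\<close> \<open>Y \<subseteq> _\<close> by (intro h.hom_mult) auto
    then show ?thesis
      unfolding set_mult_def by (auto simp: image_iff) metis+
  qed
  have coset: "h ` (N #>\<^bsub>B\<^esub> z) = h ` N #>\<^bsub>B'\<^esub> h z" if "z \<in> carrier B" for z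
    using set_mult[OF N, of "{z}"] that by (simp add: r_coset_eq_set_mult)
  have cosub: "N #>\<^bsub>B\<^esub> z \<subseteq> carrier B" if "z \<in> carrier B" for z
    using N that by (rule h.G.r_coset_subset_G)
  define H where "H = homology_at A f B g C"
  define H' where "H' = homology_at A' f' B' g' C'"
  have H: "carrier H = (\<lambda>z. N #>\<^bsub>B\<^esub> z) ` Z"
    by (simp add: H_def homology_at_def carrier_FactGroup r_coset_def N_def Z_def)
  have H': "carrier H' = (\<lambda>z. h ` N #>\<^bsub>B'\<^esub> z) ` Z'"
    by (simp add: H'_def homology_at_def carrier_FactGroup r_coset_def N' Z'_def)
  have mult: "X \<otimes>\<^bsub>H\<^esub> Y = X <#>\<^bsub>B\<^esub> Y" "X' \<otimes>\<^bsub>H'\<^esub> Y' = X' <#>\<^bsub>B'\<^esub> Y'" for X Y X' Y'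
    by (simp_all add: H_def H'_def homology_at_def set_mult_def)
  have Pow: "carrier H \<subseteq> Pow (carrier B)"
    unfolding H using cosub Z by blast
  have img: "image h ` carrier H = carrier H'"
    unfolding H H' hZ[symmetric] image_image
    by (rule image_cong[OF refl], rule coset) (use Z in blast)
  have "image h \<in> hom H H'"
  proof (rule homI)
    show "h ` X \<in> carrier H'" if "X \<in> carrier H" for X
      using img that by blast
    show "h ` (X \<otimes>\<^bsub>H\<^esub> Y) = h ` X \<otimes>\<^bsub>H'\<^esub> h ` Y" if "X \<in> carrier H" "Y \<in> carrier H" for X Y
      unfolding mult by (rule set_mult) (use that Pow in blast)+
  qed
  \<comment> \<open>Cosets are subsets of \<open>carrier B\<close>, and an injective map has an
    injective action on subsets.\<close>
  moreover have "inj_on (image h) (carrier H)"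
    using inj_on_image_Pow[OF inj] Pow by (rule inj_on_subset)
  ultimately have "image h \<in> iso H H'"
    using img by (simp add: iso_def bij_betw_def)
  then show ?thesis
    by (auto simp: is_iso_def H_def H'_def)
qed

text \<open>
  The homologies are not assumed to be groups (\<open>g \<circ> f = 1\<close> is not required), so this does not follow
  from symmetry of \<open>\<cong>\<close>.
\<close>

lemma homology_at_iso_sym:
  assumes "group B" "group B'" and h: "h \<in> iso B B'" and sub: "f ` carrier A \<subseteq> carrier B"
    and im: "h ` f ` carrier A = f' ` carrier A'" and ker: "h ` kernel B C g = kernel B' C' g'"
  shows "homology_at A' f' B' g' C' \<cong> homology_at A f B g C"
proof (rule homology_at_iso)
  have bij: "inj_on h (carrier B)" "h ` carrier B = carrier B'"
    using h by (auto simp: iso_def bij_betw_def)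
  show "inv_into (carrier B) h \<in> iso B' B"
    using \<open>group B\<close> h by (rule group.iso_set_sym)
  show "f' ` carrier A' \<subseteq> carrier B'"
    using sub bij(2) unfolding im[symmetric] by blast
  show "inv_into (carrier B) h ` f' ` carrier A' = f ` carrier A"
    unfolding im[symmetric] using bij(1) sub by (rule inv_into_image_cancel)
  show "inv_into (carrier B) h ` kernel B' C' g' = kernel B C g"
    unfolding ker[symmetric] using bij(1) by (rule inv_into_image_cancel) (auto simp: kernel_def)
qed fact+

text \<open>The families may differ off the index set. This matters for moment-angle homology, where
  the degree of a summand depends on \<open>card I\<close> and is the intended one only for
  \<open>I\<close> of the right size.\<close>

lemma sum_group_cong:
  assumes "\<And>i. i \<in> I \<Longrightarrow> G i = H i"
  shows "sum_group I G = sum_group I H"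
proof -
  have "product_group I G = product_group I H"
    using assms by (auto simp: product_group_def fun_eq_iff restrict_def intro!: PiE_cong)
  moreover have "(\<Pi>\<^sub>E i\<in>I. carrier (G i)) = (\<Pi>\<^sub>E i\<in>I. carrier (H i))"
    using assms by (intro PiE_cong) simp
  moreover have "{i \<in> I. x i \<noteq> \<one>\<^bsub>G i\<^esub>} = {i \<in> I. x i \<noteq> \<one>\<^bsub>H i\<^esub>}" for x
    using assms by auto
  ultimately show ?thesis
    unfolding sum_group_def by simp
qed

lemma carrier_sum_group_finite:
  assumes "finite I" "\<And>i. i \<in> I \<Longrightarrow> group (G i)"
  shows "carrier (sum_group I G) = (\<Pi>\<^sub>E i\<in>I. carrier (G i))"
  using assms by (simp add: carrier_sum_group)

lemma sum_group_proj_hom: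
  assumes "\<And>i. i \<in> I \<Longrightarrow> group (G i)" "i \<in> I"
  shows "(\<lambda>x. x i) \<in> hom (sum_group I G) (G i)"
  using assms by (intro homI) (auto simp: carrier_sum_group)

lemma int_pow_sum_group:
  assumes "\<And>i. i \<in> I \<Longrightarrow> group (G i)" "i \<in> I" "x \<in> carrier (sum_group I G)"
  shows "(x [^]\<^bsub>sum_group I G\<^esub> (n::int)) i = x i [^]\<^bsub>G i\<^esub> n"
  using hom_int_pow[OF sum_group_proj_hom[of I G i] assms(3)] assms by simp

text \<open>Corresponding summands are equal, so pulling families back along \<open>\<tau>\<close>
  leaves all components untouched. Its inverse is the pullback along the inverse bijection.\<close>

lemma sum_group_reindex_iso:
  assumes \<tau>: "bij_betw \<tau> J I" and fin: "finite I" and G: "\<And>i. i \<in> I \<Longrightarrow> group (G i)"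
    and H: "\<And>j. j \<in> J \<Longrightarrow> G (\<tau> j) = H j"
  shows "(\<lambda>x. \<lambda>j\<in>J. x (\<tau> j)) \<in> iso (sum_group I G) (sum_group J H)"
proof -
  have \<tau>I: "\<tau> j \<in> I" if "j \<in> J" for j using \<tau> that by (auto simp: bij_betw_def)
  have finJ: "finite J" using \<tau> fin by (simp add: bij_betw_finite)
  have GH: "group (H j)" if "j \<in> J" for j using G[OF \<tau>I[OF that]] H[OF that] by simp
  have cG: "carrier (sum_group I G) = (\<Pi>\<^sub>E i\<in>I. carrier (G i))"
    using fin G by (rule carrier_sum_group_finite)
  have cH: "carrier (sum_group J H) = (\<Pi>\<^sub>E j\<in>J. carrier (H j))"
    using finJ GH by (rule carrier_sum_group_finite)
  let ?r = "\<lambda>x. \<lambda>j\<in>J. x (\<tau> j)"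
  let ?inv = "the_inv_into J \<tau>"
  have inv: "?inv i \<in> J" "\<tau> (?inv i) = i" if "i \<in> I" for i
    using \<tau> that by (auto simp: bij_betw_def intro: the_inv_into_into f_the_inv_into_f)
  have inv': "?inv (\<tau> j) = j" if "j \<in> J" for j
    using \<tau> that by (auto simp: bij_betw_def the_inv_into_f_f)
  have closed: "?r x \<in> carrier (sum_group J H)" if "x \<in> carrier (sum_group I G)" for x
    using that \<tau>I unfolding cG cH by (auto simp: PiE_iff simp flip: H)
  have "?r \<in> hom (sum_group I G) (sum_group J H)"
    using closed \<tau>I H by (intro homI) (auto simp: restrict_def)
  moreover have "bij_betw ?r (carrier (sum_group I G)) (carrier (sum_group J H))"
  proof (rule bij_betw_byWitness[where f' = "\<lambda>y. \<lambda>i\<in>I. y (?inv i)"])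
    show "\<forall>x\<in>carrier (sum_group I G). (\<lambda>i\<in>I. ?r x (?inv i)) = x"
      unfolding cG using inv by (auto simp: PiE_iff extensional_def restrict_def)
    show "\<forall>y\<in>carrier (sum_group J H). (\<lambda>j\<in>J. (\<lambda>i\<in>I. y (?inv i)) (\<tau> j)) = y"
      unfolding cH using inv' \<tau>I by (auto simp: PiE_iff extensional_def restrict_def)
    show "?r ` carrier (sum_group I G) \<subseteq> carrier (sum_group J H)"
      using closed by blast
    show "(\<lambda>y. \<lambda>i\<in>I. y (?inv i)) ` carrier (sum_group J H) \<subseteq> carrier (sum_group I G)"
    proof clarify
      fix y assume y: "y \<in> carrier (sum_group J H)"
      have "y (?inv i) \<in> carrier (G i)" if "i \<in> I" for i
        using y inv[OF that] H[OF inv(1)[OF that]] unfolding cH by (simp add: PiE_iff)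
      then show "(\<lambda>i\<in>I. y (?inv i)) \<in> carrier (sum_group I G)"
        unfolding cG by simp
    qed
  qed
  ultimately show ?thesis
    by (simp add: iso_def)
qed

text \<open>Taking powers is an endomorphism of an abelian group. This is how the common sign leaves
  the sum defining the differential.\<close>

lemma (in comm_group) finprod_int_pow:
  assumes "f \<in> A \<rightarrow> carrier G"
  shows "finprod G (\<lambda>x. f x [^] (n::int)) A = finprod G f A [^] n"
  using assms
proof (induction A rule: infinite_finite_induct)
  case (insert a A)
  then show ?case
    by (simp add: Pi_iff int_pow_distrib)
qed simp_all

section \<open>Weight zero horizontal homology\<close>

text \<open>The restriction to the vertices makes this an extensional function, as the members of
  \<open>bicolourings K\<close> are required to be.\<close>

definition colour :: "'v set set \<Rightarrow> 'v set \<Rightarrow> 'v \<Rightarrow> nat" where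
  "colour K I = (\<lambda>v\<in>vertices K. if v \<in> I then 1 else 0)"

text \<open>Translates the source \<open>\<epsilon>'(v := 0)\<close> of a component in
  \<open>uber_diff\<close> into the source \<open>J - {v}\<close> of a component in
  \<open>double_diff\<close>.\<close>

lemma colour_remove: "v \<in> vertices K \<Longrightarrow> (colour K I)(v := 0) = colour K (I - {v})"
  by (auto simp: colour_def fun_eq_iff)

lemma bij_betw_colour:
  assumes "finite (vertices K)"
  shows "bij_betw (colour K) {I. I \<subseteq> vertices K \<and> int (card I) = n}
    {\<epsilon> \<in> bicolourings K. int (colour_length K \<epsilon>) = n}"
proof -
  have len: "colour_length K (colour K I) = card I" if "I \<subseteq> vertices K" for I
    unfolding colour_length_def colour_def using assms that
    by (simp add: sum.If_cases Int_absorb1)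
  show ?thesis
  proof (rule bij_betw_byWitness[where f' = "\<lambda>\<epsilon>. {v \<in> vertices K. \<epsilon> v = 1}"])
    show "\<forall>I\<in>{I. I \<subseteq> vertices K \<and> int (card I) = n}. {v \<in> vertices K. colour K I v = 1} = I"
      by (auto simp: colour_def)
    have inv: "colour K {v \<in> vertices K. \<epsilon> v = 1} = \<epsilon>" if "\<epsilon> \<in> bicolourings K" for \<epsilon>
      using that unfolding bicolourings_def colour_def
      by (auto simp: fun_eq_iff PiE_iff extensional_def)
    then show "\<forall>\<epsilon>\<in>{\<epsilon> \<in> bicolourings K. int (colour_length K \<epsilon>) = n}. colour K {v \<in> vertices K. \<epsilon> v = 1} = \<epsilon>"
      by blast
    show "colour K ` {I. I \<subseteq> vertices K \<and> int (card I) = n} \<subseteq> {\<epsilon> \<in> bicolourings K. int (colour_length K \<epsilon>) = n}"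
    proof clarify
      fix I assume "I \<subseteq> vertices K"
      then show "colour K I \<in> bicolourings K \<and> int (colour_length K (colour K I)) = int (card I)"
        by (simp add: len) (simp add: bicolourings_def colour_def)
    qed
    show "(\<lambda>\<epsilon>. {v \<in> vertices K. \<epsilon> v = 1}) ` {\<epsilon> \<in> bicolourings K. int (colour_length K \<epsilon>) = n}
       \<subseteq> {I. I \<subseteq> vertices K \<and> int (card I) = n}"
    proof clarify
      fix \<epsilon> assume "\<epsilon> \<in> bicolourings K"
      from inv[OF this] len[of "{v \<in> vertices K. \<epsilon> v = 1}"]
      show "{v \<in> vertices K. \<epsilon> v = 1} \<subseteq> vertices K \<and> int (card {v \<in> vertices K. \<epsilon> v = 1}) = int (colour_length K \<epsilon>)"
        by auto
    qed
  qed
qed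

lemma weight_colour:
  assumes "finite \<sigma>" "\<sigma> \<subseteq> vertices K" "I \<subseteq> vertices K"
  shows "weight (colour K I) \<sigma> = 0 \<longleftrightarrow> \<sigma> \<subseteq> I"
proof -
  have "{v \<in> \<sigma>. colour K I v = 0} = \<sigma> - I"
    using assms by (auto simp: colour_def)
  then show ?thesis
    using assms by (simp add: weight_def)
qed

text \<open>The two generating sets could differ only in the empty simplex, which has dimension
  -1.\<close>

lemma hor_chain_group_colour:
  assumes K: "simplicial_complex K" and I: "I \<subseteq> vertices K" and p: "p \<noteq> -1"
  shows "hor_chain_group K (colour K I) 0 p = aug_chain_group (full_subcomplex K I) p"
proof -
  have "weight (colour K I) \<sigma> = 0 \<longleftrightarrow> \<sigma> \<subseteq> I" if "\<sigma> \<in> K" for \<sigma>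
  proof (rule weight_colour[OF _ _ I])
    show "finite \<sigma>" using simplicial_complex_finite[OF K] that by blast
    show "\<sigma> \<subseteq> vertices K" using that by (auto simp: vertices_def)
  qed
  moreover have "\<sigma> \<noteq> {}" if "int (card \<sigma>) = p + 1" for \<sigma> :: "'a set"
    using that p by auto
  ultimately have "{\<sigma> \<in> K. weight (colour K I) \<sigma> = 0 \<and> int (card \<sigma>) = p + 1} =
    {\<sigma> \<in> insert {} (full_subcomplex K I). int (card \<sigma>) = p + 1}"
    unfolding full_subcomplex_def by blast
  then show ?thesis
    by (simp add: hor_chain_group_def aug_chain_group_def)
qed

text \<open>In dimension at least 1 every facet is nonempty and hence lies in \<open>K\<close>, and
  all faces of a simplex of \<open>K[I]\<close> have weight 0. Neither condition in
  \<open>hor_boundary\<close> then discards a face. In dimension 0 the augmented boundary would give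
  the empty simplex instead of 0.\<close>

lemma hor_boundary_colour:
  assumes K: "simplicial_complex K" and I: "I \<subseteq> vertices K" and p: "p \<ge> 1"
    and c: "c \<in> carrier (aug_chain_group (full_subcomplex K I) p)"
  shows "hor_boundary K (colour K I) c = aug_boundary c"
  unfolding hor_boundary_def aug_boundary_def
proof (rule frag_extend_eq)
  fix \<sigma> assume "\<sigma> \<in> Poly_Mapping.keys c"
  then have "\<sigma> \<in> insert {} (full_subcomplex K I)" and card: "int (card \<sigma>) = p + 1"
    using c unfolding carrier_aug_chain_group by blast+
  then have \<sigma>: "\<sigma> \<in> K" "\<sigma> \<subseteq> I"
    using p by (auto simp: full_subcomplex_def)
  have fin: "finite \<sigma>" using simplicial_complex_finite[OF K] \<sigma> by blast
  have "\<sigma> - {v} \<in> K" if "v \<in> \<sigma>" for v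
  proof -
    have "card \<sigma> = Suc (card (\<sigma> - {v}))"
      using fin that by (rule card.remove)
    then have "card (\<sigma> - {v}) \<noteq> 0"
      using card p by simp
    then have "\<sigma> - {v} \<noteq> {}"
      by (metis card.empty)
    then show ?thesis
      using simplicial_complex_face[OF K \<sigma>(1), of "\<sigma> - {v}"] by blast
  qed
  moreover have "weight (colour K I) \<tau> = 0" if "\<tau> \<subseteq> \<sigma>" for \<tau>
    using that fin \<sigma> I weight_colour[of \<tau> K I] by (metis finite_subset order_trans)
  ultimately have "{v. v \<in> \<sigma> \<and> \<sigma> - {v} \<in> K \<and> weight (colour K I) (\<sigma> - {v}) = weight (colour K I) \<sigma>} = \<sigma>"
    by auto
  then show "(\<Sum>v | v \<in> \<sigma> \<and> \<sigma> - {v} \<in> K \<and> weight (colour K I) (\<sigma> - {v}) = weight (colour K I) \<sigma>.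
       frag_cmul (face_sign \<sigma> v) (frag_of (\<sigma> - {v}))) = (\<Sum>v\<in>\<sigma>. frag_cmul (face_sign \<sigma> v) (frag_of (\<sigma> - {v})))"
    by simp
qed

lemma carrier_aug_chain_group_neg:
  "p < -1 \<Longrightarrow> carrier (aug_chain_group L p) = {0}"
  unfolding carrier_aug_chain_group by (auto simp flip: keys_eq_empty)

text \<open>
  For \<open>i = -2\<close> the two chain groups differ, but the boundary of the empty simplex is \<open>0\<close>.
\<close>

lemma hor_boundaries_colour:
  assumes K: "simplicial_complex K" and I: "I \<subseteq> vertices K" and i: "i \<noteq> 0" "i \<noteq> -1"
  shows "hor_boundary K (colour K I) ` carrier (hor_chain_group K (colour K I) 0 (i + 1))
    = aug_boundary ` carrier (aug_chain_group (full_subcomplex K I) (i + 1))"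
proof (cases "i \<ge> 1")
  case True
  then show ?thesis
    using hor_boundary_colour[OF K I, of "i + 1"] hor_chain_group_colour[OF K I, of "i + 1"]
    by (intro image_cong) auto
next
  case False
  then have i: "i \<le> -2" using i by simp
  have "carrier (hor_chain_group K (colour K I) 0 (i + 1)) = {0}"
  proof -
    have "int (card \<sigma>) \<noteq> i + 1 + 1" if "\<sigma> \<in> K" for \<sigma>
    proof -
      have "finite \<sigma>" "\<sigma> \<noteq> {}"
        using K that unfolding simplicial_complex_def by blast+
      then have "card \<sigma> > 0" by (simp add: card_gt_0_iff)
      then show ?thesis using i by simp
    qed
    then have empty: "{\<sigma> \<in> K. weight (colour K I) \<sigma> = 0 \<and> int (card \<sigma>) = i + 1 + 1} = {}"
      by blast
    show ?thesis
      unfolding hor_chain_group_def empty free_Abelian_group_def by simp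
  qed
  moreover have "aug_boundary c = 0" if "c \<in> carrier (aug_chain_group (full_subcomplex K I) (i + 1))" for c
    unfolding aug_boundary_def
  proof (rule frag_extend_eq_0)
    fix \<sigma> assume "\<sigma> \<in> Poly_Mapping.keys c"
    then have \<sigma>: "\<sigma> \<in> insert {} (full_subcomplex K I)" "int (card \<sigma>) = i + 1 + 1"
      using that unfolding carrier_aug_chain_group by blast+
    moreover have "finite \<sigma>"
      using simplicial_complex_finite[OF simplicial_complex_full_subcomplex[OF K] \<sigma>(1)] .
    moreover have "card \<sigma> = 0" using \<sigma>(2) i by simp
    ultimately have "\<sigma> = {}" by simp
    then show "(\<Sum>v\<in>\<sigma>. frag_cmul (face_sign \<sigma> v) (frag_of (\<sigma> - {v}))) = 0" by simp
  qed
  moreover have "0 \<in> carrier (aug_chain_group (full_subcomplex K I) (i + 1))"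
    by (simp add: carrier_aug_chain_group)
  ultimately show ?thesis
    by (auto simp: hor_boundary_def image_iff intro: bexI[of _ 0])
qed

text \<open>For \<open>i \<ge> 1\<close> both complexes have the same chains in dimensions
  \<open>i\<close> and \<open>i + 1\<close> and the same boundaries on them; for
  \<open>i \<le> -2\<close> there are no nonzero chains in dimension \<open>i\<close>. At
  \<open>i = 0\<close> the boundaries of vertices differ, and at \<open>i = -1\<close> the
  generators do.\<close>

lemma hor_homology_colour:
  assumes K: "simplicial_complex K" and I: "I \<subseteq> vertices K" and i: "i \<noteq> 0" "i \<noteq> -1"
  shows "hor_homology K (colour K I) 0 i = reduced_homology (full_subcomplex K I) i"
proof -
  have "hor_boundary K (colour K I) c = aug_boundary c"
    if "c \<in> carrier (aug_chain_group (full_subcomplex K I) i)" for c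
  proof (cases "i \<ge> 1")
    case True
    then show ?thesis by (rule hor_boundary_colour[OF K I _ that])
  next
    case False
    then have "c = 0" using that i carrier_aug_chain_group_neg[of i "full_subcomplex K I"] by simp
    then show ?thesis by (simp add: hor_boundary_def aug_boundary_def)
  qed
  \<comment> \<open>A kernel sees only the neutral element of the target, which is 0 in both chain
    groups.\<close>
  then have "kernel (aug_chain_group (full_subcomplex K I) i) (hor_chain_group K (colour K I) 0 (i - 1)) (hor_boundary K (colour K I))
    = kernel (aug_chain_group (full_subcomplex K I) i) (aug_chain_group (full_subcomplex K I) (i - 1)) aug_boundary"
    by (auto simp: kernel_def hor_chain_group_def)
  then show ?thesis
    unfolding hor_homology_def reduced_homology_def homology_at_def
    by (simp add: hor_chain_group_colour[OF K I i(2)] hor_boundaries_colour[OF K I i])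
qed

lemma image_Collect_iff:
  "(\<And>x. x \<in> A \<Longrightarrow> Q (h x) \<longleftrightarrow> P x) \<Longrightarrow> h ` {x \<in> A. P x} = {y \<in> h ` A. Q y}"
  by blast

lemma frag_extend_cmul_of: "frag_extend (\<lambda>\<sigma>. frag_cmul n (frag_of \<sigma>)) c = frag_cmul n c"
proof -
  have "frag_extend (\<lambda>\<sigma>. frag_cmul n (frag_of \<sigma>)) c = frag_cmul n (frag_extend frag_of c)"
    by (simp add: frag_extend_def frag_cmul_sum mult.commute)
  then show ?thesis
    by (simp flip: frag_expansion)
qed

text \<open>A simplex of \<open>K[J - {v}]\<close> does not contain \<open>v\<close>, so recolouring
  \<open>v\<close> keeps its weight at 0 and the component never kills it. What is left is the
  factor \<open>(-1)^s\<close>, where \<open>s\<close> counts the vertices below \<open>v\<close>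
  coloured 1, that is, the elements of \<open>J - {v}\<close> below \<open>v\<close>. The same
  exponent appears in \<open>double_diff\<close>.\<close>

lemma uber_component_colour:
  assumes K: "simplicial_complex K" and J: "J \<subseteq> vertices K" and v: "v \<in> J"
    and i: "i \<noteq> 0" "i \<noteq> -1"
    and X: "X \<in> carrier (reduced_homology (full_subcomplex K (J - {v})) i)"
  shows "uber_component K 0 i v (colour K (J - {v})) (colour K J) X
    = inclusion_map (full_subcomplex K J) i X
        [^]\<^bsub>reduced_homology (full_subcomplex K J) i\<^esub> ((-1) ^ card {u \<in> J - {v}. u < v} :: int)"
proof -
  let ?n = "(-1) ^ card {u \<in> J - {v}. u < v} :: int"
  let ?L = "full_subcomplex K (J - {v})" and ?M = "full_subcomplex K J"
  let ?f = "\<lambda>\<sigma>. if weight (colour K (J - {v})) \<sigma> = weight (colour K J) \<sigma>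
          then frag_cmul ?n (frag_of \<sigma>) else 0"
  have L: "simplicial_complex ?L" and M: "simplicial_complex ?M"
    using K by (rule simplicial_complex_full_subcomplex)+
  have LM: "?L \<subseteq> ?M" by (auto simp: full_subcomplex_def)
  have sign: "{u \<in> vertices K. u < v \<and> colour K (J - {v}) u = 1} = {u \<in> J - {v}. u < v}"
    using J by (auto simp: colour_def)
  obtain c where c: "c \<in> carrier (aug_chain_group ?L i)" "aug_boundary c = 0"
    and Xc: "X = aug_boundary ` carrier (aug_chain_group ?L (i + 1)) #>\<^bsub>aug_chain_group ?L i\<^esub> c"
    using X by (rule reduced_homologyE[OF L])
  interpret L: three_term_complex "aug_chain_group ?L (i + 1)" "aug_chain_group ?L i" "aug_chain_group ?L (i - 1)"
    aug_boundary aug_boundary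
    using L by (rule three_term_complex_aug)
  \<comment> \<open>\<open>quotient_map\<close> takes a union over the whole coset, so the map has
    to be simplified on every chain in \<open>X\<close>, not only on the representative
    \<open>c\<close>.\<close>
  have f: "frag_extend ?f x = frag_cmul ?n x" if "x \<in> X" for x
  proof -
    have "X \<subseteq> carrier (aug_chain_group ?L i)"
      unfolding Xc using subgroup.subset[OF L.subgroup_boundaries] c(1) by (rule L.B.r_coset_subset_G)
    then have x: "x \<in> carrier (aug_chain_group ?L i)" using that by blast
    have "frag_extend ?f x = frag_extend (\<lambda>\<sigma>. frag_cmul ?n (frag_of \<sigma>)) x"
    proof (rule frag_extend_eq)
      fix \<sigma> assume "\<sigma> \<in> Poly_Mapping.keys x"
      then have "\<sigma> \<in> insert {} ?L"
        using x unfolding carrier_aug_chain_group by blast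
      then have "finite \<sigma>" "\<sigma> \<subseteq> J - {v}"
        using simplicial_complex_finite[OF L] by (auto simp: full_subcomplex_def)
      then have "weight (colour K (J - {v})) \<sigma> = 0" "weight (colour K J) \<sigma> = 0"
        using J weight_colour[of \<sigma> K "J - {v}"] weight_colour[of \<sigma> K J] by blast+
      then show "?f \<sigma> = frag_cmul ?n (frag_of \<sigma>)" by simp
    qed
    then show ?thesis by (simp add: frag_extend_cmul_of)
  qed
  have "uber_component K 0 i v (colour K (J - {v})) (colour K J) X
    = quotient_map (aug_chain_group ?M i) (aug_boundary ` carrier (aug_chain_group ?M (i + 1))) (frag_extend ?f) X"
    unfolding uber_component_def sign hor_boundaries_colour[OF K J i] hor_chain_group_colour[OF K J i(2)] ..
  also have "\<dots> = quotient_map (aug_chain_group ?M i) (aug_boundary ` carrier (aug_chain_group ?M (i + 1))) (frag_cmul ?n) X"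
    by (rule quotient_map_cong) (rule f)
  also have "\<dots> = (aug_boundary ` carrier (aug_chain_group ?M (i + 1)) #>\<^bsub>aug_chain_group ?M i\<^esub> c)
             [^]\<^bsub>reduced_homology ?M i\<^esub> ?n"
    unfolding Xc by (rule reduced_homology_mult_map[OF L M LM c])
  also have "\<dots> = inclusion_map ?M i X [^]\<^bsub>reduced_homology ?M i\<^esub> ?n"
    unfolding Xc inclusion_map_coset(1)[OF L M LM c] ..
  finally show ?thesis .
qed

text \<open>Raising to the power \<open>s\<close> is an involution fixing the neutral element, since
  \<open>(x [^] s) [^] s = x\<close>.\<close>

lemma (in group) int_pow_sign_eq_one_iff:
  assumes "x \<in> carrier G" "s * s = (1 :: int)"
  shows "x [^] s = \<one> \<longleftrightarrow> x = \<one>"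
  using assms int_pow_pow[OF assms(1), of s s] by (metis int_pow_1 int_pow_one)

section \<open>Comparison of the two complexes\<close>

context
  fixes K :: "'v::linorder set set" and i :: int
  assumes K: "simplicial_complex K" and fin: "finite K" and i: "i \<noteq> 0" "i \<noteq> -1"
begin

text \<open>These are arbitrary vertex sets of size \<open>n\<close>, not simplices of
  \<open>K\<close>. The size is an integer so that \<open>j - 1\<close> makes sense for every
  \<open>j\<close>; a negative size gives the empty index set.\<close>

private definition "faces n = {I. I \<subseteq> vertices K \<and> int (card I) = n}"
private definition "RH I = reduced_homology (full_subcomplex K I) i"
private definition "M n = sum_group (faces n) RH"
private definition "U n = uber_chain_group K n 0 i"
private definition "dU n = uber_diff K n 0 i"
text \<open>The bidegrees \<open>(i - n + 1, 2 * n)\<close> form the line on which the summands have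
  degree \<open>i\<close>; the differential moves along it from \<open>n\<close> to
  \<open>n + 1\<close>.\<close>

private definition "dM n = double_diff K (i - n + 1) (2 * n)"
private definition "sgn_v J v = ((-1) ^ card {u \<in> J - {v}. u < v} :: int)"
text \<open>The factor \<open>(-1)^(p + 1)\<close> at \<open>p = i\<close>. The absolute value
  yields a natural exponent of the same parity.\<close>

private definition "s = ((-1) ^ nat \<bar>i + 1\<bar> :: int)"
private definition "inc J = inclusion_map (full_subcomplex K J) i"
private definition "\<rho> n x = (\<lambda>I\<in>faces n. x (colour K I))"

section \<open>Index sets and groups of the two complexes\<close>

private lemma s_square: "s * s = 1"
  unfolding s_def power_mult_distrib[symmetric] by simp

private lemma finite_vertices: "finite (vertices K)"
  unfolding vertices_def using fin simplicial_complex_finite[OF K] by blast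

private lemma facesD:
  assumes "I \<in> faces n"
  shows "I \<subseteq> vertices K" "finite I"
proof -
  show "I \<subseteq> vertices K" using assms by (simp add: faces_def)
  then show "finite I" using finite_vertices by (rule finite_subset)
qed

private lemma finite_faces: "finite (faces n)"
proof (rule finite_subset)
  show "faces n \<subseteq> Pow (vertices K)" using facesD(1) by blast
  show "finite (Pow (vertices K))" using finite_vertices by simp
qed

private lemma faces_remove: "J \<in> faces (n + 1) \<Longrightarrow> v \<in> J \<Longrightarrow> J - {v} \<in> faces n"
proof -
  assume J: "J \<in> faces (n + 1)" and "v \<in> J"
  then have "card J = Suc (card (J - {v}))"
    using facesD(2) by (intro card.remove)
  then show "J - {v} \<in> faces n"
    using J unfolding faces_def by auto
qed

private lemma comm_group_RH: "comm_group (RH I)"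
  unfolding RH_def by (intro comm_group_reduced_homology simplicial_complex_full_subcomplex K)

private lemma group_RH: "group (RH I)"
  using comm_group_RH by (rule comm_group.axioms(2))

private lemma carrier_M: "carrier (M n) = (\<Pi>\<^sub>E I\<in>faces n. carrier (RH I))"
  unfolding M_def using finite_faces group_RH by (rule carrier_sum_group_finite)

private lemma group_M: "group (M n)"
  unfolding M_def using group_RH by simp

private lemma hor_homology_RH: "I \<subseteq> vertices K \<Longrightarrow> hor_homology K (colour K I) 0 i = RH I"
  unfolding RH_def using K i by (intro hor_homology_colour)

private lemma colours_cases:
  assumes "\<epsilon> \<in> {\<epsilon> \<in> bicolourings K. int (colour_length K \<epsilon>) = n}"
  obtains I where "I \<in> faces n" "\<epsilon> = colour K I"
  using assms bij_betw_colour[OF finite_vertices, of n] unfolding bij_betw_def faces_def by blast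

private lemma colour_in:
  "I \<in> faces n \<Longrightarrow> colour K I \<in> {\<epsilon> \<in> bicolourings K. int (colour_length K \<epsilon>) = n}"
  using bij_betw_colour[OF finite_vertices, of n] unfolding bij_betw_def faces_def by blast

private lemma finite_colours: "finite {\<epsilon> \<in> bicolourings K. int (colour_length K \<epsilon>) = n}"
  using bij_betw_finite[OF bij_betw_colour[OF finite_vertices, of n]] finite_faces[of n]
  by (simp add: faces_def)

private lemma group_hor_homology:
  assumes "\<epsilon> \<in> {\<epsilon> \<in> bicolourings K. int (colour_length K \<epsilon>) = n}"
  shows "group (hor_homology K \<epsilon> 0 i)"
  using assms
proof (rule colours_cases)
  fix I assume I: "I \<in> faces n" "\<epsilon> = colour K I"
  show ?thesis
    unfolding I(2) hor_homology_RH[OF facesD(1)[OF I(1)]] by (rule group_RH)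
qed

private lemma group_U: "group (U n)"
  unfolding U_def uber_chain_group_def using group_hor_homology by (rule sum_group)

private lemma carrier_U:
  "carrier (U n) = (\<Pi>\<^sub>E \<epsilon>\<in>{\<epsilon> \<in> bicolourings K. int (colour_length K \<epsilon>) = n}. carrier (hor_homology K \<epsilon> 0 i))"
  unfolding U_def uber_chain_group_def using finite_colours group_hor_homology by (rule carrier_sum_group_finite)

private lemma moment_angle_homology_M:
  "moment_angle_homology K (i - n + 1) (2 * n) = M n"
proof -
  have "{I. I \<subseteq> vertices K \<and> 2 * int (card I) = 2 * n} = faces n"
    by (auto simp: faces_def)
  then show ?thesis
    unfolding moment_angle_homology_def M_def
    by (simp add: RH_def faces_def cong: conj_cong) (rule sum_group_cong, auto simp: RH_def)
qed

private lemma rho_iso: "\<rho> n \<in> iso (U n) (M n)"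
  unfolding U_def M_def uber_chain_group_def \<rho>_def
proof (rule sum_group_reindex_iso)
  show "bij_betw (colour K) (faces n) {\<epsilon> \<in> bicolourings K. int (colour_length K \<epsilon>) = n}"
    unfolding faces_def using finite_vertices by (rule bij_betw_colour)
qed (use finite_colours group_hor_homology hor_homology_RH facesD in blast)+

section \<open>The differential on moment-angle homology\<close>

private lemma inc_hom: "inc J \<in> hom (RH (J - {v})) (RH J)"
  unfolding inc_def RH_def
  by (intro inclusion_map_hom simplicial_complex_full_subcomplex K) (auto simp: full_subcomplex_def)

private lemma inc_closed:
  assumes "y \<in> carrier (M n)" "J \<in> faces (n + 1)" "v \<in> J"
  shows "inc J (y (J - {v})) \<in> carrier (RH J)"
  using assms(1) faces_remove[OF assms(2,3)] inc_hom[of J v] unfolding carrier_M hom_def by blast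

private lemma dM_eq:
  "dM n y = (\<lambda>J\<in>faces (n + 1). finprod (RH J) (\<lambda>v. inc J (y (J - {v})) [^]\<^bsub>RH J\<^esub> (s * sgn_v J v)) J)"
proof -
  have "{J. J \<subseteq> vertices K \<and> 2 * int (card J) = 2 * n + 2} = faces (n + 1)"
    by (auto simp: faces_def)
  then show ?thesis
    unfolding dM_def double_diff_def Let_def RH_def inc_def s_def sgn_v_def by simp
qed

private lemma dM_closed:
  assumes "y \<in> carrier (M n)"
  shows "dM n y \<in> carrier (M (n + 1))"
  unfolding dM_eq carrier_M
proof (rule restrict_PiE_iff[THEN iffD2], rule ballI)
  fix J assume "J \<in> faces (n + 1)"
  then show "finprod (RH J) (\<lambda>v. inc J (y (J - {v})) [^]\<^bsub>RH J\<^esub> (s * sgn_v J v)) J \<in> carrier (RH J)"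
    using inc_closed[OF assms]
    by (intro comm_monoid.finprod_closed comm_group.axioms(1)[OF comm_group_RH] Pi_I
        group.int_pow_closed group_RH) auto
qed

text \<open>Needed to move the exponent \<open>s\<close> from a value of \<open>dM n\<close> to its
  argument when images are compared. Each component is a product of powers of homomorphisms into an
  abelian group.\<close>

private lemma dM_hom: "dM n \<in> hom (M n) (M (n + 1))"
proof (rule homI)
  fix x y assume x: "x \<in> carrier (M n)" and y: "y \<in> carrier (M n)"
  have "finprod (RH J) (\<lambda>v. inc J ((x \<otimes>\<^bsub>M n\<^esub> y) (J - {v})) [^]\<^bsub>RH J\<^esub> (s * sgn_v J v)) J
    = finprod (RH J) (\<lambda>v. inc J (x (J - {v})) [^]\<^bsub>RH J\<^esub> (s * sgn_v J v)) J \<otimes>\<^bsub>RH J\<^esub>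
      finprod (RH J) (\<lambda>v. inc J (y (J - {v})) [^]\<^bsub>RH J\<^esub> (s * sgn_v J v)) J"
    if J: "J \<in> faces (n + 1)" for J
  proof -
    interpret R: comm_group "RH J" by (rule comm_group_RH)
    have "inc J ((x \<otimes>\<^bsub>M n\<^esub> y) (J - {v})) [^]\<^bsub>RH J\<^esub> (s * sgn_v J v)
      = inc J (x (J - {v})) [^]\<^bsub>RH J\<^esub> (s * sgn_v J v) \<otimes>\<^bsub>RH J\<^esub> inc J (y (J - {v})) [^]\<^bsub>RH J\<^esub> (s * sgn_v J v)"
      if v: "v \<in> J" for v
    proof -
      have "J - {v} \<in> faces n" using J v by (rule faces_remove)
      then have "inc J ((x \<otimes>\<^bsub>M n\<^esub> y) (J - {v})) = inc J (x (J - {v})) \<otimes>\<^bsub>RH J\<^esub> inc J (y (J - {v}))"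
        using hom_mult[OF inc_hom[of J v], of "x (J - {v})" "y (J - {v})"] x y
        unfolding carrier_M by (simp add: M_def PiE_iff)
      then show ?thesis
        using inc_closed[OF x J v] inc_closed[OF y J v] by (simp add: R.int_pow_distrib)
    qed
    then have "finprod (RH J) (\<lambda>v. inc J ((x \<otimes>\<^bsub>M n\<^esub> y) (J - {v})) [^]\<^bsub>RH J\<^esub> (s * sgn_v J v)) J
      = finprod (RH J) (\<lambda>v. inc J (x (J - {v})) [^]\<^bsub>RH J\<^esub> (s * sgn_v J v) \<otimes>\<^bsub>RH J\<^esub>
          inc J (y (J - {v})) [^]\<^bsub>RH J\<^esub> (s * sgn_v J v)) J"
      using inc_closed[OF x J] inc_closed[OF y J] by (intro R.finprod_cong') auto
    also have "\<dots> = finprod (RH J) (\<lambda>v. inc J (x (J - {v})) [^]\<^bsub>RH J\<^esub> (s * sgn_v J v)) J \<otimes>\<^bsub>RH J\<^esub>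
      finprod (RH J) (\<lambda>v. inc J (y (J - {v})) [^]\<^bsub>RH J\<^esub> (s * sgn_v J v)) J"
      using inc_closed[OF x J] inc_closed[OF y J] by (intro R.finprod_multf) auto
    finally show ?thesis .
  qed
  then show "dM n (x \<otimes>\<^bsub>M n\<^esub> y) = dM n x \<otimes>\<^bsub>M (n + 1)\<^esub> dM n y"
    unfolding dM_eq by (auto simp: M_def restrict_def fun_eq_iff)
qed (rule dM_closed)

section \<open>The ueber differential expressed through vertex sets\<close>

private lemma dU_colour:
  assumes x: "x \<in> carrier (U n)" and J: "J \<in> faces (n + 1)"
  shows "dU n x (colour K J) = finprod (RH J) (\<lambda>v. inc J (\<rho> n x (J - {v})) [^]\<^bsub>RH J\<^esub> sgn_v J v) J"
proof -
  interpret R: comm_group "RH J" by (rule comm_group_RH)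
  have JV: "J \<subseteq> vertices K" using J by (rule facesD)
  have \<rho>x: "\<rho> n x \<in> carrier (M n)"
    using rho_iso[of n] x by (auto simp: iso_def hom_def)
  have J1: "{v \<in> vertices K. colour K J v = 1} = J"
    using JV by (auto simp: colour_def)
  have "uber_component K 0 i v ((colour K J)(v := 0)) (colour K J) (x ((colour K J)(v := 0)))
     = inc J (\<rho> n x (J - {v})) [^]\<^bsub>RH J\<^esub> sgn_v J v" if v: "v \<in> J" for v
  proof -
    have I: "J - {v} \<in> faces n" using J v by (rule faces_remove)
    have "x (colour K (J - {v})) = \<rho> n x (J - {v})" using I by (simp add: \<rho>_def)
    moreover have "\<rho> n x (J - {v}) \<in> carrier (RH (J - {v}))"
      using \<rho>x I unfolding carrier_M by blast
    ultimately show ?thesis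
      using uber_component_colour[OF K JV v i, of "\<rho> n x (J - {v})"] v JV
      by (simp add: colour_remove subset_iff RH_def inc_def sgn_v_def)
  qed
  then have "finprod (RH J) (\<lambda>v. uber_component K 0 i v ((colour K J)(v := 0)) (colour K J) (x ((colour K J)(v := 0)))) J
    = finprod (RH J) (\<lambda>v. inc J (\<rho> n x (J - {v})) [^]\<^bsub>RH J\<^esub> sgn_v J v) J"
    using inc_closed[OF \<rho>x J] by (intro R.finprod_cong') auto
  then show ?thesis
    using colour_in[OF J] unfolding dU_def uber_diff_def
    by (simp add: J1[simplified] hor_homology_RH[OF JV])
qed

private lemma dU_closed:
  assumes x: "x \<in> carrier (U n)"
  shows "dU n x \<in> carrier (U (n + 1))"
proof -
  have \<rho>x: "\<rho> n x \<in> carrier (M n)"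
    using rho_iso[of n] x by (auto simp: iso_def hom_def)
  have "dU n x \<epsilon> \<in> carrier (hor_homology K \<epsilon> 0 i)"
    if "\<epsilon> \<in> {\<epsilon> \<in> bicolourings K. int (colour_length K \<epsilon>) = n + 1}" for \<epsilon>
    using that
  proof (rule colours_cases)
    fix J assume J: "J \<in> faces (n + 1)" "\<epsilon> = colour K J"
    have "finprod (RH J) (\<lambda>v. inc J (\<rho> n x (J - {v})) [^]\<^bsub>RH J\<^esub> sgn_v J v) J \<in> carrier (RH J)"
      using inc_closed[OF \<rho>x J(1)]
      by (intro comm_monoid.finprod_closed comm_group.axioms(1)[OF comm_group_RH] Pi_I
        group.int_pow_closed group_RH) auto
    then show ?thesis
      using dU_colour[OF x J(1)] hor_homology_RH[OF facesD(1)[OF J(1)]] J(2) by simp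
  qed
  moreover have "dU n x \<in> extensional {\<epsilon> \<in> bicolourings K. int (colour_length K \<epsilon>) = n + 1}"
    by (simp add: dU_def uber_diff_def)
  ultimately show ?thesis
    unfolding carrier_U PiE_iff by blast
qed

text \<open>The vertex-dependent signs \<open>sgn_v J v\<close> already agree on the two sides. The
  remaining factor \<open>s\<close> is common to all summands of all components, so it becomes a
  power in the whole direct sum.\<close>

private lemma dM_rho:
  assumes x: "x \<in> carrier (U n)"
  shows "dM n (\<rho> n x) = \<rho> (n + 1) (dU n x) [^]\<^bsub>M (n + 1)\<^esub> s"
proof -
  have \<rho>x: "\<rho> n x \<in> carrier (M n)"
    using rho_iso[of n] x by (auto simp: iso_def hom_def)
  have \<rho>d: "\<rho> (n + 1) (dU n x) \<in> carrier (M (n + 1))"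
    using rho_iso[of "n + 1"] dU_closed[OF x] by (auto simp: iso_def hom_def)
  have pow: "\<rho> (n + 1) (dU n x) [^]\<^bsub>M (n + 1)\<^esub> s \<in> carrier (M (n + 1))"
    using \<rho>d by (rule group.int_pow_closed[OF group_M])
  have "dM n (\<rho> n x) J = (\<rho> (n + 1) (dU n x) [^]\<^bsub>M (n + 1)\<^esub> s) J" if J: "J \<in> faces (n + 1)" for J
  proof -
    interpret R: comm_group "RH J" by (rule comm_group_RH)
    note closed = inc_closed[OF \<rho>x J]
    have "dM n (\<rho> n x) J = finprod (RH J) (\<lambda>v. inc J (\<rho> n x (J - {v})) [^]\<^bsub>RH J\<^esub> (s * sgn_v J v)) J"
      using J by (simp add: dM_eq)
    also have "\<dots> = finprod (RH J) (\<lambda>v. (inc J (\<rho> n x (J - {v})) [^]\<^bsub>RH J\<^esub> sgn_v J v) [^]\<^bsub>RH J\<^esub> s) J"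
      using closed by (intro R.finprod_cong') (auto simp: R.int_pow_pow mult.commute)
    also have "\<dots> = finprod (RH J) (\<lambda>v. inc J (\<rho> n x (J - {v})) [^]\<^bsub>RH J\<^esub> sgn_v J v) J [^]\<^bsub>RH J\<^esub> s"
      using closed by (intro R.finprod_int_pow) auto
    also have "\<dots> = \<rho> (n + 1) (dU n x) J [^]\<^bsub>RH J\<^esub> s"
      using J by (simp add: \<rho>_def[of "n + 1"] dU_colour[OF x J])
    also have "\<dots> = (\<rho> (n + 1) (dU n x) [^]\<^bsub>M (n + 1)\<^esub> s) J"
      unfolding M_def using J \<rho>d[unfolded M_def] group_RH
      by (intro int_pow_sum_group[symmetric]) auto
    finally show ?thesis .
  qed
  then show ?thesis
    using dM_closed[OF \<rho>x] pow unfolding carrier_M by (intro PiE_ext)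
qed

section \<open>Comparison of the homology groups\<close>

lemma zero_degree_uberhomology_iso_double_homology:
  "zero_degree_uberhomology K j i \<cong> double_homology K (i - j + 1) (2 * j)"
  "double_homology K (i - j + 1) (2 * j) \<cong> zero_degree_uberhomology K j i"
proof -
  have closed: "dU (j - 1) ` carrier (U (j - 1)) \<subseteq> carrier (U j)"
    and im: "\<rho> j ` dU (j - 1) ` carrier (U (j - 1)) = dM (j - 1) ` carrier (M (j - 1))"
    and ker: "\<rho> j ` kernel (U j) (U (j + 1)) (dU j) = kernel (M j) (M (j + 1)) (dM j)"
  proof -
    show "dU (j - 1) ` carrier (U (j - 1)) \<subseteq> carrier (U j)"
      using dU_closed[of _ "j - 1"] by auto
    interpret d: group_hom "M (j - 1)" "M j" "dM (j - 1)"
      using dM_hom[of "j - 1"] group_M by (simp add: group_hom_def group_hom_axioms_def)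
    have \<rho>U: "\<rho> n ` carrier (U n) = carrier (M n)" "inj_on (\<rho> n) (carrier (U n))" for n
      using rho_iso[of n] by (auto simp: iso_def bij_betw_def)
    \<comment> \<open>The sign is moved to the argument of the homomorphism
      \<open>dM (j - 1)\<close>: applying \<open>s\<close> a second time cancels the one from
      \<open>dM_rho\<close>.\<close>
    have \<rho>d: "\<rho> j (dU (j - 1) x) = dM (j - 1) (\<rho> (j - 1) x [^]\<^bsub>M (j - 1)\<^esub> s)" if x: "x \<in> carrier (U (j - 1))" for x
    proof -
      have mem: "\<rho> j (dU (j - 1) x) \<in> carrier (M j)"
        using dU_closed[OF x] \<rho>U(1)[of j] by auto
      have "dM (j - 1) (\<rho> (j - 1) x [^]\<^bsub>M (j - 1)\<^esub> s) = dM (j - 1) (\<rho> (j - 1) x) [^]\<^bsub>M j\<^esub> s"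
        using x \<rho>U(1) by (intro d.hom_int_pow) blast
      also have "\<dots> = (\<rho> j (dU (j - 1) x) [^]\<^bsub>M j\<^esub> s) [^]\<^bsub>M j\<^esub> s"
        using dM_rho[OF x] by simp
      also have "\<dots> = \<rho> j (dU (j - 1) x)"
        using mem by (simp add: d.H.int_pow_pow s_square)
      finally show ?thesis by simp
    qed
    show "\<rho> j ` dU (j - 1) ` carrier (U (j - 1)) = dM (j - 1) ` carrier (M (j - 1))"
    proof -
      \<comment> \<open>Raising to the power \<open>s\<close> is an involution, so the modified
        arguments still run through the whole group and the image is unchanged.\<close>
      have "(\<lambda>y. y [^]\<^bsub>M (j - 1)\<^esub> s) ` carrier (M (j - 1)) = carrier (M (j - 1))"
      proof
        show "carrier (M (j - 1)) \<subseteq> (\<lambda>y. y [^]\<^bsub>M (j - 1)\<^esub> s) ` carrier (M (j - 1))"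
        proof
          fix y assume y: "y \<in> carrier (M (j - 1))"
          then have "y = (y [^]\<^bsub>M (j - 1)\<^esub> s) [^]\<^bsub>M (j - 1)\<^esub> s"
            by (simp add: d.G.int_pow_pow s_square)
          then show "y \<in> (\<lambda>y. y [^]\<^bsub>M (j - 1)\<^esub> s) ` carrier (M (j - 1))"
            using y by blast
        qed
      qed auto
      moreover have "\<rho> j ` dU (j - 1) ` carrier (U (j - 1))
        = dM (j - 1) ` (\<lambda>y. y [^]\<^bsub>M (j - 1)\<^esub> s) ` \<rho> (j - 1) ` carrier (U (j - 1))"
        unfolding image_image by (rule image_cong[OF refl]) (rule \<rho>d)
      ultimately show ?thesis by (simp only: \<rho>U)
    qed
    show "\<rho> j ` kernel (U j) (U (j + 1)) (dU j) = kernel (M j) (M (j + 1)) (dM j)"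
    proof -
      interpret \<rho>: group_hom "U (j + 1)" "M (j + 1)" "\<rho> (j + 1)"
        using rho_iso[of "j + 1"] group_U group_M
        by (simp add: group_hom_def group_hom_axioms_def iso_def)
      \<comment> \<open>For kernels the sign is harmless at each element, and the injective
        homomorphism \<open>\<rho> (j + 1)\<close> reflects the neutral element.\<close>
      have iff: "dM j (\<rho> j x) = \<one>\<^bsub>M (j + 1)\<^esub> \<longleftrightarrow> dU j x = \<one>\<^bsub>U (j + 1)\<^esub>" if x: "x \<in> carrier (U j)" for x
      proof -
        have "dM j (\<rho> j x) = \<one>\<^bsub>M (j + 1)\<^esub> \<longleftrightarrow> \<rho> (j + 1) (dU j x) = \<one>\<^bsub>M (j + 1)\<^esub>"
          unfolding dM_rho[OF x] using dU_closed[OF x] s_square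
          by (intro \<rho>.H.int_pow_sign_eq_one_iff \<rho>.hom_closed)
        also have "\<dots> \<longleftrightarrow> dU j x = \<one>\<^bsub>U (j + 1)\<^esub>"
        proof
          assume "\<rho> (j + 1) (dU j x) = \<one>\<^bsub>M (j + 1)\<^esub>"
          then have "\<rho> (j + 1) (dU j x) = \<rho> (j + 1) \<one>\<^bsub>U (j + 1)\<^esub>"
            by (rule trans) (rule \<rho>.hom_one[symmetric])
          then show "dU j x = \<one>\<^bsub>U (j + 1)\<^esub>"
            by (rule inj_onD[OF \<rho>U(2) _ dU_closed[OF x] \<rho>.G.one_closed])
        next
          assume "dU j x = \<one>\<^bsub>U (j + 1)\<^esub>"
          then show "\<rho> (j + 1) (dU j x) = \<one>\<^bsub>M (j + 1)\<^esub>"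
            by (simp only: \<rho>.hom_one)
        qed
        finally show ?thesis .
      qed
      show ?thesis
        unfolding kernel_def \<rho>U(1)[of j, symmetric] by (rule image_Collect_iff) (rule iff)
    qed
  qed
  have double: "double_homology K (i - j + 1) (2 * j)
    = homology_at (M (j - 1)) (dM (j - 1)) (M j) (dM j) (M (j + 1))"
  proof -
    \<comment> \<open>The neighbouring bidegrees are rewritten as the points
      \<open>n = j - 1\<close> and \<open>n = j + 1\<close> of the same line.\<close>
    have idx: "i - j + 1 + 1 = i - (j - 1) + 1" "i - j + 1 - 1 = i - (j + 1) + 1"
      "2 * j - 2 = 2 * (j - 1)" "2 * j + 2 = 2 * (j + 1)"
      by simp_all
    show ?thesis
      unfolding double_homology_def idx moment_angle_homology_M dM_def ..
  qed
  have uber: "zero_degree_uberhomology K j i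
    = homology_at (U (j - 1)) (dU (j - 1)) (U j) (dU j) (U (j + 1))"
    by (simp add: zero_degree_uberhomology_def uberhomology_def U_def dU_def)
  show "zero_degree_uberhomology K j i \<cong> double_homology K (i - j + 1) (2 * j)"
    unfolding double uber using group_U group_M rho_iso closed im ker by (rule homology_at_iso)
  show "double_homology K (i - j + 1) (2 * j) \<cong> zero_degree_uberhomology K j i"
    unfolding double uber using group_U group_M rho_iso closed im ker by (rule homology_at_iso_sym)
qed

end

theorem theorem1:
  fixes K :: "'v::linorder set set" and m :: nat
  assumes "simplicial_complex K" and "finite K" and "connected_complex K"
    and "card (vertices K) = m"
  shows "(\<forall>i j :: int. i \<noteq> 0 \<and> i \<noteq> -1 \<longrightarrow>
            zero_degree_uberhomology K j i \<cong> double_homology K (i - j + 1) (2 * j)) \<and>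
         (\<forall>k l :: int. l - k \<noteq> 0 \<and> l - k \<noteq> 1 \<longrightarrow>
            double_homology K (- k) (2 * l) \<cong> zero_degree_uberhomology K l (l - k - 1))"
proof (intro conjI allI impI)
  fix i j :: int assume "i \<noteq> 0 \<and> i \<noteq> -1"
  then show "zero_degree_uberhomology K j i \<cong> double_homology K (i - j + 1) (2 * j)"
    using zero_degree_uberhomology_iso_double_homology[OF assms(1,2)] by blast
next
  fix k l :: int assume "l - k \<noteq> 0 \<and> l - k \<noteq> 1"
  \<comment> \<open>This is the case \<open>i = l - k - 1\<close>, \<open>j = l\<close>; the
    excluded values 1 and 0 of \<open>l - k\<close> are \<open>i = 0\<close> and
    \<open>i = -1\<close>.\<close>
  then have "double_homology K (l - k - 1 - l + 1) (2 * l) \<cong> zero_degree_uberhomology K l (l - k - 1)"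
    by (intro zero_degree_uberhomology_iso_double_homology(2)[OF assms(1,2)]) auto
  moreover have "l - k - 1 - l + 1 = - k" by simp
  ultimately show "double_homology K (- k) (2 * l) \<cong> zero_degree_uberhomology K l (l - k - 1)"
    by (simp only:)
qed

end
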